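(* Let $(X,A)$ be an almost Euclidean compact pair. The following statements are equivalent: (1) the cone pair $\mathsf{C}(X,A)$ has the surjection property; (2) for every $n\geq1$ and every regular $n$-cell $C\subseteq X\setminus A$, the quotient map $q_C:(X,A)\to(\mathbb{S}_n,s)$ is not null-homotopic.
   Context: A compact pair $(X,A)$ consists of a compact metrizable space $X$ and a compact subset $A\subseteq X$. A point of a space is Euclidean if it has an open neighborhood homeomorphic to $\mathbb{R}^n$ for some $n\geq1$. A space is almost Euclidean if its Euclidean points are dense. A pair $(X,A)$ is almost Euclidean if $X\setminus A$ is almost Euclidean. Let $\mathbb{B}_n$ be the closed unit ball of $\mathbb{R}^n$ and $\mathbb{S}_{n-1}$ its boundary sphere. For $n\geq1$, a set $C\subseteq X$ is a regular $n$-cell if there is a homeomorphism $f:\mathbb{B}_n\to C$ such that $f(\mathbb{B}_n\setminus\mathbb{S}_{n-1})$ is open in $X$; then $\mathrm{op}(C)=f(\mathbb{B}_n\setminus\mathbb{S}_{n-1})$. For a regular $n$-cell $C\subseteq X\setminus A$, the quotient of $X$ obtained by collapsing $X\setminus\mathrm{op}(C)$ to a point is homeomorphic to $\mathbb{S}_n$; $q_C:(X,A)\to(\mathbb{S}_n,s)$ denotes the quotient map, where $s\in\mathbb{S}_n$ is the image of $X\setminus\mathrm{op}(C)$. A map of pairs is null-homotopic if it is homotopic, through maps of pairs, to a constant map. The cone $\mathsf{C}(X)$ is the quotient of $X\times[0,1]$ identifying all points $(x,0)$ (the tip); $X$ is embedded in it as $X\times\{1\}$, and $\mathsf{C}(\emptyset)=\emptyset$.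 The cone pair is $\mathsf{C}(X,A)=(\mathsf{C}(X),X\cup\mathsf{C}(A))$. A pair $(Z,B)$ has the surjection property if every continuous $f:Z\to Z$ with $f|_B=\mathrm{id}_B$ is surjective. *)

theory Defs
  imports "HOL-Analysis.Analysis"
begin

text \<open>Spaces are abstract topologies, so that Euclidean spaces, balls and spheres of all
  dimensions share the type \<^typ>\<open>nat \<Rightarrow> real\<close> and \<open>n\<close> can be quantified over.\<close>

section \<open>Quotient spaces\<close>

text \<open>The quotient topology on the image of \<open>X\<close> under \<open>p\<close>; points are identified
  when they have the same value under \<open>p\<close>.\<close>

definition quotient_topology :: "'a topology \<Rightarrow> ('a \<Rightarrow> 'b) \<Rightarrow> 'b topology" where
  "quotient_topology X p =
     topology (\<lambda>U. U \<subseteq> p ` topspace X \<and> openin X {x \<in> topspace X. p x \<in> U})"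

lemma openin_quotient_topology:
  "openin (quotient_topology X p) U \<longleftrightarrow>
     U \<subseteq> p ` topspace X \<and> openin X {x \<in> topspace X. p x \<in> U}"
proof -
  have "istopology (\<lambda>U. U \<subseteq> p ` topspace X \<and> openin X {x \<in> topspace X. p x \<in> U})"
    unfolding istopology_def
  proof (intro conjI allI impI)
    fix S T
    assume S: "S \<subseteq> p ` topspace X \<and> openin X {x \<in> topspace X. p x \<in> S}"
      and T: "T \<subseteq> p ` topspace X \<and> openin X {x \<in> topspace X. p x \<in> T}"
    show "S \<inter> T \<subseteq> p ` topspace X" using S by blast
    have eq: "{x \<in> topspace X. p x \<in> S \<inter> T} =
        {x \<in> topspace X. p x \<in> S} \<inter> {x \<in> topspace X. p x \<in> T}"
      by blast
    show "openin X {x \<in> topspace X. p x \<in> S \<inter> T}"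
      unfolding eq by (rule openin_Int[OF conjunct2[OF S] conjunct2[OF T]])
  next
    fix K
    assume K: "\<forall>S\<in>K. S \<subseteq> p ` topspace X \<and> openin X {x \<in> topspace X. p x \<in> S}"
    show "\<Union>K \<subseteq> p ` topspace X" using K by blast
    have eq: "{x \<in> topspace X. p x \<in> \<Union>K} = (\<Union>S\<in>K. {x \<in> topspace X. p x \<in> S})" by blast
    show "openin X {x \<in> topspace X. p x \<in> \<Union>K}"
      unfolding eq by (rule openin_Union) (use K in blast)
  qed
  then show ?thesis
    unfolding quotient_topology_def by (simp only: topology_inverse')
qed

lemma topspace_quotient_topology: "topspace (quotient_topology X p) = p ` topspace X"
proof (rule antisym)
  show "topspace (quotient_topology X p) \<subseteq> p ` topspace X"
    using openin_topspace[of "quotient_topology X p"] unfolding openin_quotient_topology by (rule conjunct1)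
  have "{x \<in> topspace X. p x \<in> p ` topspace X} = topspace X" by auto
  then show "p ` topspace X \<subseteq> topspace (quotient_topology X p)"
    by (intro openin_subset) (simp only: openin_quotient_topology openin_topspace subset_refl simp_thms)
qed

lemma quotient_map_quotient_topology: "quotient_map X (quotient_topology X p) p"
  unfolding quotient_map_def topspace_quotient_topology openin_quotient_topology by simp

section \<open>Almost Euclidean pairs\<close>

definition compact_pair :: "'a topology \<Rightarrow> 'a set \<Rightarrow> bool" where
  "compact_pair X A \<longleftrightarrow> compact_space X \<and> metrizable_space X \<and> compactin X A"

definition Euclidean_point :: "'a topology \<Rightarrow> 'a \<Rightarrow> bool" where
  "Euclidean_point X x \<longleftrightarrow>
     (\<exists>U n. openin X U \<and> x \<in> U \<and> 1 \<le> n \<and> subtopology X U homeomorphic_space Euclidean_space n)"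

definition almost_Euclidean_space :: "'a topology \<Rightarrow> bool" where
  "almost_Euclidean_space X \<longleftrightarrow> X closure_of {x \<in> topspace X. Euclidean_point X x} = topspace X"

definition almost_Euclidean_pair :: "'a topology \<Rightarrow> 'a set \<Rightarrow> bool" where
  "almost_Euclidean_pair X A \<longleftrightarrow> almost_Euclidean_space (subtopology X (topspace X - A))"

section \<open>Regular cells and their quotient maps\<close>

definition closed_unit_ball :: "nat \<Rightarrow> (nat \<Rightarrow> real) set" where
  "closed_unit_ball n = {x \<in> topspace (Euclidean_space n). (\<Sum>i<n. (x i)\<^sup>2) \<le> 1}"

definition unit_sphere :: "nat \<Rightarrow> (nat \<Rightarrow> real) set" where
  "unit_sphere n = {x \<in> topspace (Euclidean_space n). (\<Sum>i<n. (x i)\<^sup>2) = 1}"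

text \<open>\<open>unit_sphere n\<close> is the boundary sphere of \<open>closed_unit_ball n\<close>, so it has dimension
  \<open>n - 1\<close>, whereas the library's \<^const>\<open>nsphere\<close> is indexed by its dimension.\<close>

definition cell_chart :: "'a topology \<Rightarrow> nat \<Rightarrow> 'a set \<Rightarrow> ((nat \<Rightarrow> real) \<Rightarrow> 'a) \<Rightarrow> bool" where
  "cell_chart X n C f \<longleftrightarrow>
     homeomorphic_map (subtopology (Euclidean_space n) (closed_unit_ball n)) (subtopology X C) f \<and>
     openin X (f ` (closed_unit_ball n - unit_sphere n))"

definition regular_cell :: "'a topology \<Rightarrow> nat \<Rightarrow> 'a set \<Rightarrow> bool" where
  "regular_cell X n C \<longleftrightarrow> 1 \<le> n \<and> C \<subseteq> topspace X \<and> (\<exists>f. cell_chart X n C f)"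

text \<open>Collapses the complement of \<open>U\<close> to the point \<^const>\<open>None\<close>.\<close>

definition collapse_complement :: "'a set \<Rightarrow> 'a \<Rightarrow> 'a option" where
  "collapse_complement U x = (if x \<in> U then Some x else None)"

text \<open>The pair \<open>q, s\<close> is a quotient map from \<open>X\<close> to the \<open>n\<close>-sphere collapsing the
  complement of \<open>op(C) = f(open ball)\<close>, together with the image \<open>s\<close> of that complement.
  The set \<open>op(C)\<close> does not depend on the chart \<open>f\<close> (invariance of domain), and two choices
  of \<open>q, s\<close> differ by a homeomorphism of the sphere.\<close>

definition cell_quotient_map ::
  "'a topology \<Rightarrow> nat \<Rightarrow> 'a set \<Rightarrow> ('a \<Rightarrow> nat \<Rightarrow> real) \<Rightarrow> (nat \<Rightarrow> real) \<Rightarrow> bool" where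
  "cell_quotient_map X n C q s \<longleftrightarrow>
     (\<exists>f U h. cell_chart X n C f \<and> U = f ` (closed_unit_ball n - unit_sphere n) \<and>
        homeomorphic_map (quotient_topology X (collapse_complement U)) (nsphere n) h \<and>
        q = h \<circ> collapse_complement U \<and> s = h None)"

definition pair_null_homotopic ::
  "'a topology \<Rightarrow> 'a set \<Rightarrow> 'b topology \<Rightarrow> 'b set \<Rightarrow> ('a \<Rightarrow> 'b) \<Rightarrow> bool" where
  "pair_null_homotopic X A Y B g \<longleftrightarrow>
     (\<exists>c \<in> topspace Y. homotopic_with (\<lambda>k. k ` A \<subseteq> B) X Y g (\<lambda>x. c))"

section \<open>Cone pairs and the surjection property\<close>

text \<open>\<^const>\<open>None\<close> is the tip. It is a point of the cone only if the base is nonempty, so the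
  cone over the empty set is empty.\<close>

definition cone_proj :: "'a \<times> real \<Rightarrow> ('a \<times> real) option" where
  "cone_proj z = (if snd z = 0 then None else Some z)"

definition cone_space :: "'a topology \<Rightarrow> ('a \<times> real) option topology" where
  "cone_space X = quotient_topology (prod_topology X (top_of_set {0..1::real})) cone_proj"

definition cone_pair_subset :: "'a topology \<Rightarrow> 'a set \<Rightarrow> ('a \<times> real) option set" where
  "cone_pair_subset X A = cone_proj ` (topspace X \<times> {1}) \<union> cone_proj ` (A \<times> {0..1})"

definition surjection_property :: "'a topology \<Rightarrow> 'a set \<Rightarrow> bool" where
  "surjection_property Z B \<longleftrightarrow>
     (\<forall>f. continuous_map Z Z f \<and> (\<forall>b\<in>B. f b = b) \<longrightarrow> f ` topspace Z = topspace Z)"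

end

theory Submission
  imports Defs
begin

text \<open>Collapsing the complement of an open cell \<open>op(C)\<close> turns a self-map of the cone that avoids a level
  of the cone over \<open>op(C)\<close> into a null-homotopy of \<open>q\<close>, and conversely.

  Suppose first that a self-map \<open>F\<close> of the cone fixes the distinguished subset, but is not onto. Its image is
  closed, and Euclidean points are dense in \<open>X - A\<close>, so \<open>F\<close> misses \<open>C \<times> {t}\<close> for some small cell
  \<open>C\<close> and some \<open>0 < t < 1\<close>. Cut along that level, the cone maps to the sphere by \<open>q\<close> on the upper part and by
  a constant elsewhere. Composing with \<open>F\<close> gives a map from the cone to the sphere that extends \<open>q\<close> and
  is \<open>s\<close> over \<open>A\<close>; but a map from the cone is a homotopy to a constant
  (\<open>not_surjection_property_imp_null_homotopic\<close>).

  Conversely, let \<open>q\<close> be null-homotopic. The sphere is mapped into the cone as the top of the cell together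
  with its side, the cone over the boundary of \<open>C\<close>, by a map \<open>l\<close>. The composite \<open>l \<circ> q\<close> is homotopic to
  the inclusion of \<open>X\<close> as the top: expand the cell radially and let everything outside sink to the tip
  (\<open>cell_expansion\<close>). This homotopy followed by the null-homotopy of \<open>l \<circ> q\<close> is a map of the
  cone to itself that avoids the interior of the cone over the cell. To be the identity over \<open>A\<close>, it must
  leave no time for the null-homotopy there, and a function vanishing exactly on \<open>A\<close>
  (\<open>closed_set_is_zero_set\<close>) regulates this
  (\<open>null_homotopic_imp_not_surjection_property\<close>).\<close>

section \<open>Topology of the cone\<close>

definition cone_height :: "('a \<times> real) option \<Rightarrow> real" where
  "cone_height z = (case z of None \<Rightarrow> 0 | Some y \<Rightarrow> snd y)"

text \<open>Meaningful only away from the tip.\<close>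

definition cone_base :: "('a \<times> real) option \<Rightarrow> 'a" where
  "cone_base z = fst (the z)"

lemma cone_height_proj [simp]: "cone_height (cone_proj y) = snd y"
  by (simp add: cone_height_def cone_proj_def)

lemma cone_base_proj [simp]: "snd y \<noteq> 0 \<Longrightarrow> cone_base (cone_proj y) = fst y"
  by (simp add: cone_base_def cone_proj_def)

lemma cone_proj_eq_iff: "cone_proj y = cone_proj y' \<longleftrightarrow> snd y = 0 \<and> snd y' = 0 \<or> y = y'"
  by (auto simp: cone_proj_def)

lemma topspace_cone_space: "topspace (cone_space X) = cone_proj ` (topspace X \<times> {0..1})"
  by (simp add: cone_space_def topspace_quotient_topology)

lemma cone_proj_in_cone_space [simp]:
  "x \<in> topspace X \<Longrightarrow> 0 \<le> t \<Longrightarrow> t \<le> 1 \<Longrightarrow> cone_proj (x, t) \<in> topspace (cone_space X)"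
  by (auto simp: topspace_cone_space)

lemma in_cone_spaceE:
  assumes "z \<in> topspace (cone_space X)"
  obtains x t where "z = cone_proj (x, t)" "x \<in> topspace X" "0 \<le> t" "t \<le> 1"
  using assms by (auto simp: topspace_cone_space)

lemma quotient_map_cone_proj:
  "quotient_map (prod_topology X (top_of_set {0..1})) (cone_space X) cone_proj"
  unfolding cone_space_def by (rule quotient_map_quotient_topology)

lemmas continuous_map_cone_proj = quotient_imp_continuous_map [OF quotient_map_cone_proj]

lemma continuous_map_into_cone:
  assumes "continuous_map Y X p" and "continuous_map Y (top_of_set {0..1}) h"
  shows "continuous_map Y (cone_space X) (\<lambda>y. cone_proj (p y, h y))"
proof -
  have "continuous_map Y (cone_space X) (cone_proj \<circ> (\<lambda>y. (p y, h y)))"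
    using assms by (intro continuous_map_compose [OF _ continuous_map_cone_proj] continuous_map_pairedI)
  then show ?thesis
    by (simp add: o_def)
qed

lemma continuous_map_cone_height: "continuous_map (cone_space X) (top_of_set {0..1}) cone_height"
proof (rule continuous_compose_quotient_map [OF quotient_map_cone_proj])
  show "continuous_map (prod_topology X (top_of_set {0..1})) (top_of_set {0..1}) (cone_height \<circ> cone_proj)"
    by (simp add: o_def continuous_map_snd)
qed

text \<open>Away from the tip nothing is identified, so the open cylinder \<open>U \<times> (0, 1]\<close> is saturated.
  This is what makes the base coordinate continuous off the tip and lets points of equal positive
  height be separated.\<close>

lemma openin_cone_cylinder:
  assumes "openin X U"
  shows "openin (cone_space X) (cone_proj ` (U \<times> {0<..1}))"
  unfolding cone_space_def openin_quotient_topology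
proof
  have U: "U \<subseteq> topspace X"
    using assms openin_subset by blast
  then show "cone_proj ` (U \<times> {0<..1}) \<subseteq> cone_proj ` topspace (prod_topology X (top_of_set {0..1}))"
    by fastforce
  have eq: "{y \<in> topspace (prod_topology X (top_of_set {0..1})). cone_proj y \<in> cone_proj ` (U \<times> {0<..1})}
      = U \<times> {0<..1}"
    using U by (auto simp: image_iff cone_proj_eq_iff)
  have "{0<..1::real} = {0..1} \<inter> {0<..}"
    by auto
  then have "openin (top_of_set {0..1}) {0<..1::real}"
    using openin_open_Int[of "{0<..}"] by auto
  then show "openin (prod_topology X (top_of_set {0..1}))
      {y \<in> topspace (prod_topology X (top_of_set {0..1})). cone_proj y \<in> cone_proj ` (U \<times> {0<..1})}"
    unfolding eq using assms by (simp add: openin_prod_Times_iff)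
qed

lemma continuous_map_cone_base:
  "continuous_map (subtopology (cone_space X) {z. cone_height z \<noteq> 0}) X cone_base"
  unfolding continuous_map_def
proof (intro conjI allI impI)
  show "cone_base \<in> topspace (subtopology (cone_space X) {z. cone_height z \<noteq> 0}) \<rightarrow> topspace X"
    by (auto simp: topspace_cone_space)
  fix U assume U: "openin X U"
  then have sub: "U \<subseteq> topspace X"
    by (rule openin_subset)
  have "{z \<in> topspace (subtopology (cone_space X) {z. cone_height z \<noteq> 0}). cone_base z \<in> U}
    = cone_proj ` (U \<times> {0<..1}) \<inter> {z. cone_height z \<noteq> 0}"
  proof (intro equalityI subsetI)
    fix z assume "z \<in> {z \<in> topspace (subtopology (cone_space X) {z. cone_height z \<noteq> 0}). cone_base z \<in> U}"
    then obtain x t where "z = cone_proj (x, t)" "x \<in> U" "t \<in> {0<..1}"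
      by (auto simp: topspace_cone_space)
    then show "z \<in> cone_proj ` (U \<times> {0<..1}) \<inter> {z. cone_height z \<noteq> 0}"
      by auto
  next
    fix z assume "z \<in> cone_proj ` (U \<times> {0<..1}) \<inter> {z. cone_height z \<noteq> 0}"
    then obtain x t where "z = cone_proj (x, t)" "x \<in> U" "t \<in> {0<..1}"
      by auto
    then show "z \<in> {z \<in> topspace (subtopology (cone_space X) {z. cone_height z \<noteq> 0}). cone_base z \<in> U}"
      using sub by auto
  qed
  then show "openin (subtopology (cone_space X) {z. cone_height z \<noteq> 0})
     {z \<in> topspace (subtopology (cone_space X) {z. cone_height z \<noteq> 0}). cone_base z \<in> U}"
    unfolding openin_subtopology using openin_cone_cylinder[OF U] by metis
qed

lemma compact_space_cone: "compact_space X \<Longrightarrow> compact_space (cone_space X)"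
  using quotient_map_cone_proj[of X]
  by (metis compact_Icc compact_space_prod_topology compact_space_subtopology compactin_euclidean_iff
      compact_space_def image_compactin quotient_imp_continuous_map quotient_imp_surjective_map)

text \<open>Points of different heights are separated by the height, points of equal height by cylinders over
  disjoint open sets of the base.\<close>

lemma Hausdorff_space_cone:
  assumes "Hausdorff_space X"
  shows "Hausdorff_space (cone_space X)"
  unfolding Hausdorff_space_def
proof (intro allI impI)
  fix z w
  assume *: "z \<in> topspace (cone_space X) \<and> w \<in> topspace (cone_space X) \<and> z \<noteq> w"
  then obtain x t y u where z: "z = cone_proj (x, t)" and w: "w = cone_proj (y, u)"
    and x: "x \<in> topspace X" "t \<in> {0..1}" and y: "y \<in> topspace X" "u \<in> {0..1}"
    by (auto simp: topspace_cone_space)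
  show "\<exists>U V. openin (cone_space X) U \<and> openin (cone_space X) V \<and> z \<in> U \<and> w \<in> V \<and> disjnt U V"
  proof (cases "t = u")
    case False
    have "Hausdorff_space (top_of_set {0..1::real})"
      by (simp add: Hausdorff_space_subtopology)
    then obtain U V where UV: "openin (top_of_set {0..1}) U" "openin (top_of_set {0..1}) V" "t \<in> U" "u \<in> V" "disjnt U V"
      using False x(2) y(2) unfolding Hausdorff_space_def topspace_euclidean_subtopology by metis
    show ?thesis
    proof (intro exI conjI)
      let ?P = "\<lambda>S. {z \<in> topspace (cone_space X). cone_height z \<in> S}"
      show "openin (cone_space X) (?P U)" "openin (cone_space X) (?P V)"
        using UV continuous_map_cone_height openin_continuous_map_preimage by blast+
      show "z \<in> ?P U" "w \<in> ?P V" "disjnt (?P U) (?P V)"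
        using UV z w * by (auto simp: disjnt_iff)
    qed
  next
    case True
    then have "x \<noteq> y" "t \<noteq> 0"
      using * z w by (auto simp: cone_proj_eq_iff)
    then obtain U V where UV: "openin X U" "openin X V" "x \<in> U" "y \<in> V" "disjnt U V"
      using assms x y unfolding Hausdorff_space_def by blast
    show ?thesis
    proof (intro exI conjI)
      show "openin (cone_space X) (cone_proj ` (U \<times> {0<..1}))" "openin (cone_space X) (cone_proj ` (V \<times> {0<..1}))"
        using UV openin_cone_cylinder by blast+
      show "z \<in> cone_proj ` (U \<times> {0<..1})" "w \<in> cone_proj ` (V \<times> {0<..1})"
        using UV z w x y True \<open>t \<noteq> 0\<close> by auto
      show "disjnt (cone_proj ` (U \<times> {0<..1})) (cone_proj ` (V \<times> {0<..1}))"
        using UV by (auto simp: disjnt_iff cone_proj_eq_iff)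
    qed
  qed
qed

section \<open>Closed sets as zero sets\<close>

text \<open>The truncated distance to \<open>A\<close>. The bound \<open>1/2\<close>, strictly below \<open>1\<close>, makes \<open>1 - d\<close>
  invertible, and for \<open>A = {}\<close> the function still vanishes nowhere.\<close>

lemma closed_set_is_zero_set:
  assumes "metrizable_space X" and "closedin X A"
  obtains d :: "'a \<Rightarrow> real" where "continuous_map X (top_of_set {0..1/2}) d"
    and "\<And>x. x \<in> topspace X \<Longrightarrow> d x = 0 \<longleftrightarrow> x \<in> A"
proof (cases "A = {}")
  case True
  show thesis
    by (rule that[of "\<lambda>x. 1/2"]) (auto simp: True)
next
  case False
  obtain M m where Mm: "Metric_space M m" and X: "X = Metric_space.mtopology M m"
    using assms(1) unfolding metrizable_space_def by blast
  interpret Metric_space M m by (rule Mm)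
  define g where "g = (\<lambda>x. INF a\<in>A. m x a)"
  have AM: "A \<subseteq> M"
    using assms(2) closedin_subset X by fastforce
  have bdd: "bdd_below (m x ` A)" for x
    by (rule bdd_belowI[of _ 0]) auto
  have le: "g x \<le> m x a" if "a \<in> A" for x a
    unfolding g_def using that bdd by (simp add: cINF_lower)
  have g0: "0 \<le> g x" for x
    unfolding g_def using False by (intro cINF_greatest) auto
  have lip: "g x - g y \<le> m x y" if "x \<in> M" "y \<in> M" for x y
  proof -
    have "g x - m x y \<le> m y a" if a: "a \<in> A" for a
      using le[OF a, of x] triangle[of x y a] \<open>x \<in> M\<close> \<open>y \<in> M\<close> AM a by fastforce
    then have "g x - m x y \<le> g y"
      unfolding g_def[of] using False by (intro cINF_greatest) auto
    then show ?thesis by simp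
  qed
  have "Lipschitz_continuous_map Self euclidean_metric g"
    unfolding Lipschitz_continuous_map_def
  proof (intro conjI exI ballI)
    fix x y assume "x \<in> mspace Self" "y \<in> mspace Self"
    then show "mdist euclidean_metric (g x) (g y) \<le> 1 * mdist Self x y"
      using lip[of x y] lip[of y x] by (simp add: dist_real_def commute)
  qed auto
  then have contg: "continuous_map X euclideanreal g"
    using Lipschitz_continuous_imp_continuous_map[of Self euclidean_metric g]
    by (simp add: X mtopology_of_euclidean mtopology_of_def)
  have zero: "g x = 0 \<longleftrightarrow> x \<in> A" if x: "x \<in> M" for x
  proof
    assume "x \<in> A" then show "g x = 0"
      using le[of x x] g0[of x] x by simp
  next
    assume gx: "g x = 0"
    show "x \<in> A"
    proof (rule ccontr)
      assume "x \<notin> A"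
      then obtain r where r: "r > 0" "mball x r \<subseteq> M - A"
        using assms(2) x unfolding X closedin_def openin_mtopology topspace_mtopology by blast
      have "r \<le> m x a" if "a \<in> A" for a
        proof (rule ccontr)
        assume "\<not> r \<le> m x a"
        then have "a \<in> mball x r"
          using that x AM by auto
        then show False using r that by blast
      qed
      then have "r \<le> g x"
        unfolding g_def using False by (intro cINF_greatest) auto
      then show False using gx r by simp
    qed
  qed
  show thesis
  proof
    show "continuous_map X (top_of_set {0..1/2}) (\<lambda>x. min (1/2) (g x))"
      unfolding continuous_map_in_subtopology using contg g0
      by (auto intro!: continuous_map_real_min)
    show "(min (1/2) (g x) = 0) = (x \<in> A)" if "x \<in> topspace X" for x
      using zero[of x] that X by (auto simp: min_def)
  qed
qed

section \<open>Euclidean balls\<close>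

abbreviation enorm :: "nat \<Rightarrow> (nat \<Rightarrow> real) \<Rightarrow> real" where
  "enorm n x \<equiv> L2_set x {..<n}"

lemma Euclidean_space_eq_top_of_set: "Euclidean_space n = top_of_set {x. \<forall>i\<ge>n. x i = 0}"
  by (simp add: Euclidean_space_def euclidean_product_topology)

lemma openin_Euclidean_space_iff:
  "openin (Euclidean_space n) S \<longleftrightarrow> (\<exists>T. open T \<and> S = topspace (Euclidean_space n) \<inter> T)"
  unfolding Euclidean_space_eq_top_of_set openin_open by simp

lemma nsphere_eq_top_of_set: "nsphere n = top_of_set {x. (\<Sum>i\<le>n. (x i)\<^sup>2) = 1 \<and> (\<forall>i>n. x i = 0)}"
  by (simp add: nsphere euclidean_product_topology)

lemma continuous_on_enorm [continuous_intros]: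
  assumes "continuous_on S f"
  shows "continuous_on S (\<lambda>x. enorm n (f x))"
proof -
  have "continuous_on S (\<lambda>x. f x i)" for i
    using assms by (rule continuous_on_product_then_coordinatewise)
  then show ?thesis
    unfolding L2_set_def
    by (intro continuous_on_real_sqrt continuous_on_sum continuous_on_power)
qed

lemma enorm_scale: "enorm n (\<lambda>i. c * x i) = \<bar>c\<bar> * enorm n x"
  by (simp add: L2_set_def power_mult_distrib real_sqrt_mult flip: sum_distrib_left)

lemma closed_unit_ball_eq: "closed_unit_ball n = {x. (\<forall>i\<ge>n. x i = 0) \<and> enorm n x \<le> 1}"
  by (auto simp: closed_unit_ball_def topspace_Euclidean_space L2_set_def)

lemma unit_sphere_eq: "unit_sphere n = {x. (\<forall>i\<ge>n. x i = 0) \<and> enorm n x = 1}"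
  by (auto simp: unit_sphere_def topspace_Euclidean_space L2_set_def)

lemma subtopology_closed_unit_ball:
  "subtopology (Euclidean_space n) (closed_unit_ball n) = top_of_set (closed_unit_ball n)"
  unfolding Euclidean_space_eq_top_of_set subtopology_subtopology
  by (rule arg_cong[where f = top_of_set]) (auto simp: closed_unit_ball_eq)

text \<open>Every coordinate lies in \<open>[-1, 1]\<close>, so the ball is a closed subset of the Tychonoff cube.\<close>

lemma compact_closed_unit_ball: "compact (closed_unit_ball n)"
proof -
  have "compactin (product_topology (\<lambda>i. euclidean) UNIV) (Pi\<^sub>E UNIV (\<lambda>i::nat. {-1..1::real}))"
    by (simp add: compactin_PiE)
  then have cpt: "compact (Pi\<^sub>E UNIV (\<lambda>i::nat. {-1..1::real}))"
    by (simp add: euclidean_product_topology)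
  have sub: "closed_unit_ball n \<subseteq> Pi\<^sub>E UNIV (\<lambda>i::nat. {-1..1::real})"
  proof
    fix x assume x: "x \<in> closed_unit_ball n"
    have "\<bar>x i\<bar> \<le> 1" for i
    proof (cases "i < n")
      case True
      have "\<bar>x i\<bar> \<le> L2_set (\<lambda>i. \<bar>x i\<bar>) {..<n}"
        using True by (intro member_le_L2_set) auto
      moreover have "L2_set (\<lambda>i. \<bar>x i\<bar>) {..<n} = enorm n x"
        by (simp add: L2_set_def)
      ultimately show ?thesis
        using x by (simp add: closed_unit_ball_eq)
    qed (use x in \<open>auto simp: closed_unit_ball_eq\<close>)
    then show "x \<in> Pi\<^sub>E UNIV (\<lambda>i::nat. {-1..1::real})"
      by (auto simp: PiE_UNIV_domain Pi_iff abs_le_iff minus_le_iff)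
  qed
  have "closedin (Euclidean_space n) (topspace (Euclidean_space n))"
    by simp
  then have "closed (topspace (Euclidean_space n))"
    by (rule closedin_Euclidean_imp_closed)
  moreover have "closed {x. enorm n x \<le> 1}"
    by (intro closed_Collect_le continuous_intros)
  moreover have "closed_unit_ball n = topspace (Euclidean_space n) \<inter> {x. enorm n x \<le> 1}"
    by (auto simp: closed_unit_ball_eq topspace_Euclidean_space)
  ultimately have "closed (closed_unit_ball n)"
    by auto
  then show ?thesis
    using compact_Int_closed[OF cpt] sub by (metis inf.absorb_iff2)
qed

section \<open>Cells and their radial expansion\<close>

lemma continuous_map_paste_closed:
  assumes "closedin Y {y \<in> topspace Y. P y}" and "closedin Y {y \<in> topspace Y. Q y}"
    and "\<And>y. y \<in> topspace Y \<Longrightarrow> P y \<or> Q y"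
    and "continuous_map (subtopology Y {y. P y}) Z f"
    and "continuous_map (subtopology Y {y. Q y}) Z g"
    and "\<And>y. y \<in> topspace Y \<Longrightarrow> P y \<Longrightarrow> Q y \<Longrightarrow> f y = g y"
  shows "continuous_map Y Z (\<lambda>y. if P y then f y else g y)"
proof (rule pasting_lemma_closed[where I = UNIV and T = "\<lambda>b. {y \<in> topspace Y. if b then P y else Q y}"
      and f = "\<lambda>b. if b then f else g"])
  fix b
  have "subtopology Y {y \<in> topspace Y. if b then P y else Q y} = subtopology Y {y. if b then P y else Q y}"
    by (metis Collect_conj_eq Collect_mem_eq subtopology_restrict)
  then show "continuous_map (subtopology Y {y \<in> topspace Y. if b then P y else Q y}) Z (if b then f else g)"
    using assms by auto
  show "closedin Y {y \<in> topspace Y. if b then P y else Q y}"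
    using assms(1,2) by (cases b) simp_all
next
  fix x assume "x \<in> topspace Y"
  then show "\<exists>j. j \<in> UNIV \<and> x \<in> {y \<in> topspace Y. if j then P y else Q y} \<and>
         (if P x then f x else g x) = (if j then f else g) x"
    using assms(3) by (intro exI[of _ "P x"]) auto
qed (use assms in \<open>auto split: if_splits\<close>)

text \<open>Everything needed of a chart, with the norm of its inverse as radial coordinate: the open cell is
  where this norm is below \<open>1\<close>.\<close>

lemma cell_chartE:
  assumes X: "Hausdorff_space X" and chart: "cell_chart X n C \<phi>" and C: "C \<subseteq> topspace X"
    and U: "U = \<phi> ` (closed_unit_ball n - unit_sphere n)"
  obtains \<psi> where
    "continuous_map (top_of_set (closed_unit_ball n)) X \<phi>"
    "continuous_map (subtopology X C) (top_of_set (closed_unit_ball n)) \<psi>"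
    "\<And>v. v \<in> closed_unit_ball n \<Longrightarrow> \<phi> v \<in> C \<and> \<psi> (\<phi> v) = v"
    "\<And>x. x \<in> C \<Longrightarrow> \<psi> x \<in> closed_unit_ball n \<and> \<phi> (\<psi> x) = x"
    "closedin X C" "openin X U" "U \<subseteq> C"
    "\<And>x. x \<in> C \<Longrightarrow> x \<in> U \<longleftrightarrow> enorm n (\<psi> x) < 1"
proof -
  let ?B = "top_of_set (closed_unit_ball n)"
  have hm: "homeomorphic_map ?B (subtopology X C) \<phi>" and op: "openin X U"
    using chart unfolding cell_chart_def subtopology_closed_unit_ball U by auto
  then obtain \<psi> where \<psi>: "homeomorphic_maps ?B (subtopology X C) \<phi> \<psi>"
    unfolding homeomorphic_map_maps by blast
  have top: "topspace (subtopology X C) = C"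
    using C by auto
  have cont: "continuous_map ?B (subtopology X C) \<phi>" "continuous_map (subtopology X C) ?B \<psi>"
    using \<psi> by (auto simp: homeomorphic_maps_def)
  have inv1: "\<phi> v \<in> C \<and> \<psi> (\<phi> v) = v" if "v \<in> closed_unit_ball n" for v
    using \<psi> cont(1) that top unfolding homeomorphic_maps_def continuous_map_def by fastforce
  have inv2: "\<psi> x \<in> closed_unit_ball n \<and> \<phi> (\<psi> x) = x" if "x \<in> C" for x
    using \<psi> cont(2) that top unfolding homeomorphic_maps_def continuous_map_def by fastforce
  have "compactin X (\<phi> ` closed_unit_ball n)"
    using image_compactin[of ?B "closed_unit_ball n" X \<phi>] cont(1) compact_closed_unit_ball
    by (simp add: continuous_map_in_subtopology compactin_subtopology)
  moreover have "\<phi> ` closed_unit_ball n = C"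
    using inv1 inv2 by (force simp: image_iff)
  ultimately have clo: "closedin X C"
    using X compactin_imp_closedin by blast
  have "U \<subseteq> C"
    using inv1 U by auto
  have mem: "x \<in> U \<longleftrightarrow> enorm n (\<psi> x) < 1" if x: "x \<in> C" for x
  proof
    assume "x \<in> U"
    then obtain v where v: "v \<in> closed_unit_ball n - unit_sphere n" "x = \<phi> v"
      using U by auto
    then have "\<psi> x = v"
      using inv1 by auto
    then show "enorm n (\<psi> x) < 1"
      using v by (auto simp: closed_unit_ball_eq unit_sphere_eq)
  next
    assume "enorm n (\<psi> x) < 1"
    then have "\<psi> x \<in> closed_unit_ball n - unit_sphere n"
      using inv2[OF x] by (auto simp: unit_sphere_eq)
    then show "x \<in> U"
      using inv2[OF x] U by (metis image_eqI)
  qed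
  show thesis
    using that[of \<psi>] cont inv1 inv2 clo op \<open>U \<subseteq> C\<close> mem
    by (auto simp: continuous_map_in_subtopology)
qed

text \<open>\<open>E s\<close> expands the cell radially by the factor \<open>2 / (1 + s)\<close>, cutting off at radius \<open>1\<close>, and fixes
  the complement of the open cell; \<open>\<rho>\<close> is the radius in the cell and \<open>1\<close> outside. With \<open>s = 1\<close> the
  expansion is the identity, with \<open>s = 0\<close> the inner half of the cell already covers the whole cell
  and the outer half is pushed to the boundary. At no time does a point other than the centre \<open>p\<close>
  reach \<open>p\<close>; this is why the map built from \<open>E\<close> below is not surjective.\<close>

lemma cell_expansion:
  assumes X: "Hausdorff_space X" and chart: "cell_chart X n C \<phi>" and C: "C \<subseteq> topspace X"
    and U: "U = \<phi> ` (closed_unit_ball n - unit_sphere n)"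
  obtains E :: "real \<times> 'a \<Rightarrow> 'a" and \<rho> :: "'a \<Rightarrow> real" and p :: 'a where
    "continuous_map (prod_topology (top_of_set {0..1}) X) X E"
    "continuous_map X (top_of_set {0..1}) \<rho>"
    "\<And>x. x \<in> topspace X \<Longrightarrow> \<rho> x = 1 \<longleftrightarrow> x \<notin> U"
    "\<And>s x. s \<in> {0..1} \<Longrightarrow> x \<in> topspace X - U \<Longrightarrow> E (s, x) = x"
    "\<And>x. x \<in> topspace X \<Longrightarrow> E (1, x) = x"
    "p \<in> U"
    "\<And>s x. s \<in> {0..1} \<Longrightarrow> x \<in> topspace X \<Longrightarrow> E (s, x) = p \<Longrightarrow> \<rho> x = 0"
proof -
  let ?B = "closed_unit_ball n"
  obtain \<psi> where cont\<phi>: "continuous_map (top_of_set ?B) X \<phi>"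
    and cont\<psi>: "continuous_map (subtopology X C) (top_of_set ?B) \<psi>"
    and inv1: "\<And>v. v \<in> ?B \<Longrightarrow> \<phi> v \<in> C \<and> \<psi> (\<phi> v) = v"
    and inv2: "\<And>x. x \<in> C \<Longrightarrow> \<psi> x \<in> ?B \<and> \<phi> (\<psi> x) = x"
    and clo: "closedin X C" and op: "openin X U" and UC: "U \<subseteq> C"
    and mem: "\<And>x. x \<in> C \<Longrightarrow> x \<in> U \<longleftrightarrow> enorm n (\<psi> x) < 1"
    using cell_chartE[OF assms] by blast
  have cloU: "closedin X {x \<in> topspace X. x \<notin> U}"
    using op openin_closedin_eq set_diff_eq by metis
  \<comment> \<open>Dividing by the maximum gives both the expansion and the cut-off in one continuous formula.\<close>
  define m where "m = (\<lambda>y::real \<times> (nat \<Rightarrow> real). max (enorm n (snd y)) ((1 + fst y) / 2))"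
  define sc where "sc = (\<lambda>y::real \<times> (nat \<Rightarrow> real). \<lambda>i. (1 / m y) * snd y i)"
  have m0: "m y > 0" if "y \<in> {0..1} \<times> ?B" for y
    using that by (auto simp: m_def less_max_iff_disj)
  have sc_norm: "enorm n (sc y) = enorm n (snd y) / m y" if "y \<in> {0..1} \<times> ?B" for y
    using m0[OF that] unfolding sc_def enorm_scale by simp
  have sc_in: "sc y \<in> ?B" if "y \<in> {0..1} \<times> ?B" for y
    using sc_norm[OF that] m0[OF that] that
    by (auto simp: closed_unit_ball_eq sc_def m_def divide_le_eq_1)
  have contm: "continuous_on S m" for S
    unfolding m_def by (intro continuous_intros) auto
  have contsc: "continuous_on ({0..1} \<times> ?B) sc"
    unfolding sc_def using m0
    by (intro continuous_intros contm continuous_on_product_then_coordinatewise) force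
  then have sc_map: "continuous_map (prod_topology (top_of_set {0..1}) (top_of_set ?B)) (top_of_set ?B) sc"
    using sc_in by (simp add: continuous_map_in_subtopology)
  define E where "E = (\<lambda>(s, x). if x \<in> C then \<phi> (sc (s, \<psi> x)) else x)"
  define \<rho> where "\<rho> = (\<lambda>x. if x \<in> C then enorm n (\<psi> x) else 1)"
  have out: "enorm n (\<psi> x) = 1" if "x \<in> C" "x \<notin> U" for x
    using that inv2[of x] mem[of x] by (auto simp: closed_unit_ball_eq)
  have fix_out: "\<phi> (sc (s, \<psi> x)) = x" if "x \<in> C" "x \<notin> U" "s \<in> {0..1}" for s x
  proof -
    have "m (s, \<psi> x) = 1"
      using out[OF that(1,2)] that(3) by (auto simp: m_def)
    then show ?thesis
      using inv2[OF that(1)] by (simp add: sc_def)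
  qed
  show thesis
  proof
    let ?Y = "prod_topology (top_of_set {0..1::real}) X"
    have snd: "continuous_map ?Y X snd"
      by (rule continuous_map_snd)
    have "continuous_map ?Y X (\<lambda>y. if snd y \<in> C then \<phi> (sc (fst y, \<psi> (snd y))) else snd y)"
    proof (rule continuous_map_paste_closed[where Q = "\<lambda>y. snd y \<notin> U"])
      show "closedin ?Y {y \<in> topspace ?Y. snd y \<in> C}"
        using closedin_continuous_map_preimage[OF snd clo] .
      have "{y \<in> topspace ?Y. snd y \<in> {x \<in> topspace X. x \<notin> U}} = {y \<in> topspace ?Y. snd y \<notin> U}"
        by auto
      then show "closedin ?Y {y \<in> topspace ?Y. snd y \<notin> U}"
        using closedin_continuous_map_preimage[OF snd cloU] by (simp only:)
      let ?YC = "subtopology ?Y {y. snd y \<in> C}"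
      have "continuous_map ?YC (subtopology X C) snd"
        by (auto simp: continuous_map_in_subtopology intro: continuous_map_from_subtopology snd)
      moreover have fst: "continuous_map ?YC (top_of_set {0..1}) fst"
        by (intro continuous_map_from_subtopology continuous_map_fst)
      ultimately have "continuous_map ?YC (top_of_set ?B) (\<lambda>y. \<psi> (snd y))"
        using continuous_map_compose[OF _ cont\<psi>, of ?YC snd] by (simp add: o_def)
      then have "continuous_map ?YC (prod_topology (top_of_set {0..1}) (top_of_set ?B)) (\<lambda>y. (fst y, \<psi> (snd y)))"
        by (rule continuous_map_pairedI [OF fst])
      then have "continuous_map ?YC X (\<phi> \<circ> sc \<circ> (\<lambda>y. (fst y, \<psi> (snd y))))"
        by (rule continuous_map_compose [OF _ continuous_map_compose [OF sc_map cont\<phi>]])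
      then show "continuous_map ?YC X (\<lambda>y. \<phi> (sc (fst y, \<psi> (snd y))))"
        by (simp add: o_def)
    qed (use UC fix_out in \<open>auto intro: continuous_map_from_subtopology snd\<close>)
    then show "continuous_map ?Y X E"
      by (simp add: E_def case_prod_unfold)
    have "continuous_map X euclideanreal \<rho>"
      unfolding \<rho>_def
    proof (rule continuous_map_paste_closed[where Q = "\<lambda>x. x \<notin> U"])
      show "closedin X {x \<in> topspace X. x \<in> C}" "closedin X {x \<in> topspace X. x \<notin> U}"
        using clo cloU C by (simp_all add: Collect_conj_eq inf.absorb2)
      have "continuous_map (top_of_set ?B) euclideanreal (enorm n)"
        by (simp add: continuous_intros)
      then have "continuous_map (subtopology X C) euclideanreal (enorm n \<circ> \<psi>)"
        using cont\<psi> continuous_map_compose by blast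
      then show "continuous_map (subtopology X {x. x \<in> C}) euclideanreal (\<lambda>x. enorm n (\<psi> x))"
        by (simp add: o_def)
    qed (use UC out in auto)
    then show "continuous_map X (top_of_set {0..1}) \<rho>"
      using inv2 by (auto simp: continuous_map_in_subtopology \<rho>_def closed_unit_ball_eq)
    show "\<rho> x = 1 \<longleftrightarrow> x \<notin> U" if "x \<in> topspace X" for x
      using UC mem[of x] out[of x] by (auto simp: \<rho>_def)
    show "E (s, x) = x" if "s \<in> {0..1}" "x \<in> topspace X - U" for s x
      using fix_out that by (auto simp: E_def)
    show "E (1, x) = x" if "x \<in> topspace X" for x
    proof (cases "x \<in> C")
      case True
      then have "m (1, \<psi> x) = 1"
        using inv2[of x] by (auto simp: m_def closed_unit_ball_eq)
      then show ?thesis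
        using True inv2[of x] by (simp add: E_def sc_def)
    qed (simp add: E_def)
    let ?p = "\<phi> (\<lambda>i. 0)"
    have zero: "(\<lambda>i. 0) \<in> ?B" "enorm n (\<lambda>i. 0) = 0"
      by (auto simp: closed_unit_ball_eq L2_set_def)
    have pC: "?p \<in> C" "\<psi> ?p = (\<lambda>i. 0)"
      using inv1[OF zero(1)] by auto
    then show "?p \<in> U"
      using mem[of ?p] zero(2) by simp
    show "\<rho> x = 0" if s: "s \<in> {0..1}" and x: "x \<in> topspace X" and eq: "E (s, x) = ?p" for s x
    proof -
      have xC: "x \<in> C"
        using eq pC(1) by (auto simp: E_def split: if_splits)
      then have y: "(s, \<psi> x) \<in> {0..1} \<times> ?B"
        using inv2[of x] s by auto
      have "\<phi> (sc (s, \<psi> x)) = ?p"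
        using eq xC by (simp add: E_def)
      then have "sc (s, \<psi> x) = (\<lambda>i. 0)"
        using inv1[OF sc_in[OF y]] pC(2) by metis
      then have "enorm n (\<psi> x) / m (s, \<psi> x) = 0"
        using sc_norm[OF y] zero(2) by simp
      then show ?thesis
        using m0[OF y] xC by (simp add: \<rho>_def)
    qed
  qed
qed

section \<open>Null-homotopic quotient maps yield non-surjective maps\<close>

lemma quotient_map_cell_quotient_map:
  assumes "cell_quotient_map X n C q s"
  shows "quotient_map X (nsphere n) q"
  using assms unfolding cell_quotient_map_def
  by (metis homeomorphic_map_def quotient_map_compose quotient_map_quotient_topology)

text \<open>Let \<open>H\<close> be a null-homotopy of \<open>q\<close>. Over the point of \<open>X\<close> with radius \<open>\<rho>\<close>, let \<open>G s\<close> first run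
  through the top of the cone and then, after the expansion has reached the boundary of the cell,
  down its side: \<open>G 1\<close> is the inclusion of the top, and \<open>G 0\<close> sends the complement of the open cell to
  the tip, so it factors as \<open>l \<circ> q\<close>. Following \<open>G\<close> from \<open>1\<close> to \<open>0\<close> and then \<open>l \<circ> H\<close> contracts
  the top of the cone, that is, gives a map from the cone to itself. It never enters the interior of the
  cone over the open cell, and in particular misses the point of height \<open>1/2\<close> over the centre.

  On \<open>A\<close> the first stage is \<open>G s a = (a, s)\<close> and the second is constantly the tip, whereas the map
  has to be the identity on the cone over \<open>A\<close>. Therefore the second stage gets the time \<open>d x\<close>,
  which shrinks to \<open>0\<close> exactly on \<open>A\<close>. The reparametrization \<open>\<psi>\<close> is a quotient map onto the cone (from a
  compact space to a Hausdorff one), so the continuity of the result at the cone over \<open>A\<close>, where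
  the time collapses, comes for free.\<close>

lemma null_homotopic_imp_not_surjection_property:
  assumes cp: "compact_pair X A" and C: "C \<subseteq> topspace X - A"
    and cq: "cell_quotient_map X n C q s"
    and null: "pair_null_homotopic X A (nsphere n) {s} q"
  shows "\<not> surjection_property (cone_space X) (cone_pair_subset X A)"
proof -
  have X: "compact_space X" "metrizable_space X" "Hausdorff_space X" and A: "closedin X A"
    using cp by (auto simp: compact_pair_def metrizable_imp_Hausdorff_space compactin_imp_closedin)
  obtain f U h where chart: "cell_chart X n C f" and U: "U = f ` (closed_unit_ball n - unit_sphere n)"
    and h: "homeomorphic_map (quotient_topology X (collapse_complement U)) (nsphere n) h"
    and q: "q = h \<circ> collapse_complement U"
    using cq unfolding cell_quotient_map_def by blast
  have CX: "C \<subseteq> topspace X"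
    using C by auto
  have AU: "x \<notin> U" if "x \<in> A" for x
    using cell_chartE[OF X(3) chart CX U] C that by (metis DiffD2 subsetD)
  have AX: "A \<subseteq> topspace X"
    using A closedin_subset by blast
  obtain E :: "real \<times> 'a \<Rightarrow> 'a" and \<rho> :: "'a \<Rightarrow> real" and p where contE: "continuous_map (prod_topology (top_of_set {0..1}) X) X E"
    and cont\<rho>: "continuous_map X (top_of_set {0..1}) \<rho>"
    and \<rho>1: "\<And>x. x \<in> topspace X \<Longrightarrow> \<rho> x = 1 \<longleftrightarrow> x \<notin> U"
    and E_out: "\<And>s x. s \<in> {0..1} \<Longrightarrow> x \<in> topspace X - U \<Longrightarrow> E (s, x) = x"
    and E1: "\<And>x. x \<in> topspace X \<Longrightarrow> E (1, x) = x"
    and pU: "p \<in> U"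
    and Ep: "\<And>s x. s \<in> {0..1} \<Longrightarrow> x \<in> topspace X \<Longrightarrow> E (s, x) = p \<Longrightarrow> \<rho> x = 0"
    using cell_expansion[OF X(3) chart CX U] by blast
  have pX: "p \<in> topspace X"
    using pU cell_chartE[OF X(3) chart CX U] CX by (metis subsetD)
  have \<rho>01: "0 \<le> \<rho> x \<and> \<rho> x \<le> 1" if "x \<in> topspace X" for x
    using continuous_map_funspace[OF cont\<rho>] that by (auto simp: Pi_iff)

  \<comment> \<open>The height starts to drop when \<open>\<rho> x\<close> exceeds \<open>(1 + s)/2\<close>, the radius at which the expansion meets
    the boundary of the cell.\<close>
  define G where "G = (\<lambda>(s, x). cone_proj (E (s, x), min 1 (2 + s - 2 * \<rho> x)))"
  have contG: "continuous_map (prod_topology (top_of_set {0..1}) X) (cone_space X) G"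
  proof -
    let ?Y = "prod_topology (top_of_set {0..1::real}) X"
    have "continuous_map ?Y euclideanreal fst" 
      using continuous_map_fst[of "top_of_set {0..1::real}" X] continuous_map_in_subtopology by blast
    moreover have "continuous_map ?Y euclideanreal (\<lambda>y. \<rho> (snd y))"
      using continuous_map_compose[OF continuous_map_snd cont\<rho>, of "top_of_set {0..1}"] 
      unfolding o_def by (rule continuous_map_into_fulltopology)
    ultimately have "continuous_map ?Y euclideanreal (\<lambda>y. min 1 (2 + fst y - 2 * \<rho> (snd y)))"
      by (intro continuous_intros continuous_map_real_min) auto
    then have "continuous_map ?Y (top_of_set {0..1}) (\<lambda>y. min 1 (2 + fst y - 2 * \<rho> (snd y)))"
      using \<rho>01 by (auto simp: continuous_map_in_subtopology)
        (smt (verit))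
    from continuous_map_into_cone[OF contE this] show ?thesis
      by (simp add: G_def case_prod_unfold)
  qed
  have G_out: "G (t, x) = cone_proj (x, t)" if "t \<in> {0..1}" "x \<in> topspace X" "x \<notin> U" for t x
    using that E_out[of t x] \<rho>1[of x] by (auto simp: G_def)
  have G1: "G (1, x) = cone_proj (x, 1)" if "x \<in> topspace X" for x
    using that E1 \<rho>01[of x] by (auto simp: G_def)
  have G_miss: "G (t, x) \<noteq> cone_proj (p, 1/2)" if "t \<in> {0..1}" "x \<in> topspace X" for t x
    using Ep[OF that] that by (auto simp: G_def cone_proj_eq_iff)

  have qmap: "quotient_map X (nsphere n) q"
    using cq by (rule quotient_map_cell_quotient_map)
  have q_eq: "q x = q y \<longleftrightarrow> x = y \<or> x \<notin> U \<and> y \<notin> U" if "x \<in> topspace X" "y \<in> topspace X" for x y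
  proof -
    have "inj_on h (collapse_complement U ` topspace X)"
      using h by (simp add: homeomorphic_map_def topspace_quotient_topology)
    then show ?thesis
      using that by (auto simp: q inj_on_eq_iff collapse_complement_def)
  qed
  have contG0: "continuous_map X (cone_space X) (\<lambda>x. G (0, x))"
    using continuous_map_compose[OF _ contG, of X "\<lambda>x. (0, x)"]
    by (simp add: o_def continuous_map_pairwise)
  \<comment> \<open>\<open>G 0\<close> descends along \<open>q\<close>, since it sends the complement of the open cell to the tip.\<close>
  have "G (0, x) = G (0, y)" if "x \<in> topspace X" "y \<in> topspace X" "q x = q y" for x y
    using q_eq[of x y] that G_out[of 0 x] G_out[of 0 y] by (auto simp: cone_proj_eq_iff)
  then obtain l where contl: "continuous_map (nsphere n) (cone_space X) l"
    and l_im: "l ` topspace (nsphere n) = (\<lambda>x. G (0, x)) ` topspace X"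
    and lq: "\<And>x. x \<in> topspace X \<Longrightarrow> l (q x) = G (0, x)"
    using quotient_map_lift_exists[OF qmap contG0] by blast

  obtain c and H :: "real \<times> 'a \<Rightarrow> nat \<Rightarrow> real" where c: "c \<in> topspace (nsphere n)"
    and contH: "continuous_map (prod_topology (top_of_set {0..1}) X) (nsphere n) H"
    and H0: "\<And>x. H (0, x) = q x" and H1: "\<And>x. H (1, x) = c"
    and HA: "\<And>t a. t \<in> {0..1} \<Longrightarrow> a \<in> A \<Longrightarrow> H (t, a) = s"
    using null unfolding pair_null_homotopic_def homotopic_with_def by (auto simp: image_subset_iff)
  have H_in: "H (t, x) \<in> topspace (nsphere n)" if "t \<in> {0..1}" "x \<in> topspace X" for t x
    using contH that by (auto simp: continuous_map_def)
  have qA: "q a = s" if "a \<in> A" for a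
    using HA[of 0 a] H0 that by auto
  have ls: "l s = None" if "a \<in> A" for a
    using lq[of a] qA[OF that] G_out[of 0 a] AU[OF that] AX that by (auto simp: cone_proj_def)

  obtain d :: "'a \<Rightarrow> real" where contd: "continuous_map X (top_of_set {0..1/2}) d"
    and d0: "\<And>x. x \<in> topspace X \<Longrightarrow> d x = 0 \<longleftrightarrow> x \<in> A"
    using closed_set_is_zero_set[OF X(2) A] by metis
  have d01: "0 \<le> d x \<and> d x \<le> 1/2" if "x \<in> topspace X" for x
    using continuous_map_funspace[OF contd] that by (auto simp: Pi_iff)

  let ?Y = "prod_topology (top_of_set {-1..1::real}) X"
  have fst: "continuous_map ?Y euclideanreal fst"
    using continuous_map_fst[of "top_of_set {-1..1::real}" X] continuous_map_in_subtopology by blast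
  \<comment> \<open>Time runs backwards from \<open>1\<close> (top of the cone) to \<open>-1\<close> (tip), with the change of stage at \<open>0\<close>.\<close>
  define \<Phi> where "\<Phi> = (\<lambda>(t, x). if 0 \<le> t then G (t, x) else l (H (- t, x)))"
  have cont\<Phi>: "continuous_map ?Y (cone_space X) \<Phi>"
  proof -
    have "continuous_map ?Y (cone_space X) (\<lambda>y. if 0 \<le> fst y then G y else l (H (- fst y, snd y)))"
    proof (rule continuous_map_paste_closed[where Q = "\<lambda>y. fst y \<le> 0"])
      have "closedin ?Y {y \<in> topspace ?Y. fst y \<in> {0..}}" "closedin ?Y {y \<in> topspace ?Y. fst y \<in> {..0}}"
        by (intro closedin_continuous_map_preimage[OF fst]; simp)+
      then show "closedin ?Y {y \<in> topspace ?Y. 0 \<le> fst y}" "closedin ?Y {y \<in> topspace ?Y. fst y \<le> 0}"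
        by simp_all
      let ?Y1 = "subtopology ?Y {y. 0 \<le> fst y}"
      have "continuous_map ?Y1 (prod_topology (top_of_set {0..1}) X) (\<lambda>y. (fst y, snd y))"
        by (intro continuous_map_pairedI)
          (auto simp: continuous_map_in_subtopology intro: continuous_map_from_subtopology fst continuous_map_snd)
      then show "continuous_map ?Y1 (cone_space X) G"
        using continuous_map_compose[OF _ contG] by (auto simp: o_def)
      let ?Y2 = "subtopology ?Y {y. fst y \<le> 0}"
      have "continuous_map ?Y2 (prod_topology (top_of_set {0..1}) X) (\<lambda>y. (- fst y, snd y))"
        by (intro continuous_map_pairedI)
          (auto simp: continuous_map_in_subtopology intro: continuous_map_from_subtopology continuous_map_minus fst continuous_map_snd)
      then have "continuous_map ?Y2 (cone_space X) (l \<circ> H \<circ> (\<lambda>y. (- fst y, snd y)))"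
        by (rule continuous_map_compose [OF _ continuous_map_compose [OF contH contl]])
      then show "continuous_map ?Y2 (cone_space X) (\<lambda>y. l (H (- fst y, snd y)))"
        by (simp add: o_def)
    qed (use H0 lq in \<open>force+\<close>)
    then show ?thesis
      by (rule continuous_map_eq) (auto simp: \<Phi>_def)
  qed
  \<comment> \<open>Piecewise linear in \<open>t\<close>, with values \<open>0\<close>, \<open>d x\<close>, \<open>1\<close> at \<open>t = -1, 0, 1\<close>.\<close>
  define ht where "ht = (\<lambda>(t, x). (1 + min 0 t) * d x + max 0 t * (1 - d x))"
  have ht01: "0 \<le> ht (t, x) \<and> ht (t, x) \<le> 1" if "t \<in> {-1..1}" "x \<in> topspace X" for t x
  proof (cases "0 \<le> t")
    case True
    then have "ht (t, x) = t * 1 + (1 - t) * d x"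
      by (simp add: ht_def algebra_simps)
    moreover have "(1 - t) * d x \<le> (1 - t) * 1"
      using d01[OF that(2)] that(1) by (intro mult_left_mono) auto
    moreover have "0 \<le> (1 - t) * d x"
      using d01[OF that(2)] that(1) by simp
    ultimately show ?thesis using True by simp
  next
    case False
    then have "ht (t, x) = (1 + t) * d x"
      by (simp add: ht_def)
    then show ?thesis
      using d01[OF that(2)] that(1) False by (auto intro!: mult_le_one)
  qed
  define \<psi> where "\<psi> = (\<lambda>y. cone_proj (snd y :: 'a, ht y))"
  have cont\<psi>: "continuous_map ?Y (cone_space X) \<psi>"
    unfolding \<psi>_def
  proof (rule continuous_map_into_cone)
    have "continuous_map ?Y euclideanreal (\<lambda>y. d (snd y))"
      using continuous_map_compose[OF continuous_map_snd contd, of "top_of_set {-1..1}"] 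
      unfolding o_def by (rule continuous_map_into_fulltopology)
    then have "continuous_map ?Y euclideanreal ht"
      unfolding ht_def case_prod_unfold
      by (intro continuous_intros continuous_map_real_min continuous_map_real_max fst) auto
    then show "continuous_map ?Y (top_of_set {0..1}) ht"
      using ht01 by (auto simp: continuous_map_in_subtopology)
  qed (rule continuous_map_snd)
  have \<psi>_onto: "\<exists>t\<in>{-1..1}. ht (t, x) = u" if "u \<in> {0..1}" "x \<in> topspace X" for u x
  proof (cases "d x \<le> u")
    case True
    define t where "t = (u - d x) / (1 - d x)"
    have "0 \<le> t" "t \<le> 1" "t * (1 - d x) = u - d x"
      using True that d01[OF that(2)] by (auto simp: t_def divide_le_eq_1)
    then show ?thesis
      by (intro bexI[of _ t]) (auto simp: ht_def)
  next
    case False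
    define t where "t = u / d x - 1"
    have "-1 \<le> t" "t \<le> 0" "(1 + t) * d x = u"
      using False that by (auto simp: t_def divide_le_eq_1)
    then show ?thesis
      by (intro bexI[of _ t]) (auto simp: ht_def)
  qed
  have quot: "quotient_map ?Y (cone_space X) \<psi>"
  proof (rule T1_Spaces.continuous_imp_quotient_map[OF cont\<psi>])
    show "compact_space ?Y"
      using X by (simp add: compact_space_prod_topology compact_space_subtopology)
    show "Hausdorff_space (cone_space X)"
      using X Hausdorff_space_cone by blast
    show "\<psi> ` topspace ?Y = topspace (cone_space X)"
    proof
      show "\<psi> ` topspace ?Y \<subseteq> topspace (cone_space X)"
        using cont\<psi> by (rule continuous_map_image_subset_topspace)
      show "topspace (cone_space X) \<subseteq> \<psi> ` topspace ?Y"
      proof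
        fix z assume "z \<in> topspace (cone_space X)"
        then obtain x u where z: "z = cone_proj (x, u)" "x \<in> topspace X" "u \<in> {0..1}"
          by (metis atLeastAtMost_iff in_cone_spaceE)
        then obtain t where "t \<in> {-1..1}" "ht (t, x) = u"
          using \<psi>_onto by blast
        then show "z \<in> \<psi> ` topspace ?Y"
          using z by (intro image_eqI[of _ _ "(t, x)"]) (auto simp: \<psi>_def)
      qed
    qed
  qed
  \<comment> \<open>Besides \<open>t = -1\<close>, height \<open>0\<close> occurs for all \<open>t \<le> 0\<close> over \<open>A\<close>. There the homotopy of pairs
    stays at \<open>s\<close>, so \<open>c = s\<close> and \<open>\<Phi>\<close> takes the same value.\<close>
  have \<Phi>0: "\<Phi> (t, x) = l c" if "ht (t, x) = 0" "t \<in> {-1..1}" "x \<in> topspace X" for t x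
  proof (cases "x \<in> A")
    case True
    then have "d x = 0"
      using d0 that by blast
    then have "t \<le> 0"
      using that(1) by (auto simp: ht_def)
    moreover have "l c = None"
      using HA[of 1 x] H1 ls True by auto
    moreover have "G (0, x) = None"
      using G_out[of 0 x] AU[OF True] that(3) by (simp add: cone_proj_def)
    ultimately show ?thesis
      using HA[of "- t" x] ls[OF True] True that(2) by (auto simp: \<Phi>_def)
  next
    case False
    then have d: "0 < d x" "d x \<le> 1/2"
      using d0 d01 that(3) by (auto simp: less_eq_real_def)
    have "t = -1"
    proof (cases "0 \<le> t")
      case True
      then have "d x + t * (1 - d x) = 0" "0 \<le> t * (1 - d x)"
        using that(1) d by (simp_all add: ht_def)
      then show ?thesis using d by simp
    next
      case False
      then show ?thesis
        using that(1) d by (simp add: ht_def)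
    qed
    then show ?thesis
      by (simp add: \<Phi>_def H1)
  qed
  have resp: "\<Phi> y = \<Phi> y'" if y: "y \<in> topspace ?Y" "y' \<in> topspace ?Y" "\<psi> y = \<psi> y'" for y y'
  proof (cases "ht y = 0")
    case True
    then have "ht y' = 0"
      using that by (auto simp: \<psi>_def cone_proj_eq_iff)
    then show ?thesis
      using True \<Phi>0 y by (cases y; cases y') auto
  next
    case False
    then obtain t t' x where yy: "y = (t, x)" "y' = (t', x)" and eq: "ht (t, x) = ht (t', x)"
      using y by (cases y; cases y') (auto simp: \<psi>_def cone_proj_eq_iff)
    have x: "x \<in> topspace X" and t: "t \<in> {-1..1}" "t' \<in> {-1..1}"
      using y yy by auto
    \<comment> \<open>The height increases strictly with time except over \<open>A\<close> at nonpositive times.\<close>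
    have mono: "ht (a, x) < ht (b, x)" if ab: "a < b" "b > 0 \<or> d x > 0" for a b
    proof -
      have 1: "max 0 a * (1 - d x) \<le> max 0 b * (1 - d x)" "(1 + min 0 a) * d x \<le> (1 + min 0 b) * d x"
        using ab d01[OF x] by (auto intro!: mult_right_mono)
      show ?thesis
      proof (cases "b > 0")
        case True
        then have "max 0 a * (1 - d x) < max 0 b * (1 - d x)"
          using ab d01[OF x] by (intro mult_strict_right_mono) auto
        then show ?thesis using 1 by (simp add: ht_def)
      next
        case False
        then have "(1 + min 0 a) * d x < (1 + min 0 b) * d x"
          using ab by (intro mult_strict_right_mono) auto
        then show ?thesis using 1 by (simp add: ht_def)
      qed
    qed
    have "t = t'"
    proof (cases "d x > 0")
      case True
      then show ?thesis
        using mono[of t t'] mono[of t' t] eq by force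
    next
      case dz: False
      then have "d x = 0"
        using d01[OF x] by auto
      then have "t > 0" "t' > 0"
        using False eq yy by (auto simp: ht_def)
      then show ?thesis
        using mono[of t t'] mono[of t' t] eq by force
    qed
    then show ?thesis
      using yy by simp
  qed
  obtain F where contF: "continuous_map (cone_space X) (cone_space X) F"
    and F_im: "F ` topspace (cone_space X) = \<Phi> ` topspace ?Y"
    and F\<psi>: "\<And>y. y \<in> topspace ?Y \<Longrightarrow> F (\<psi> y) = \<Phi> y"
    using quotient_map_lift_exists[OF quot cont\<Phi> resp] by blast
  have F_top: "F (cone_proj (x, 1)) = cone_proj (x, 1)" if "x \<in> topspace X" for x
    using F\<psi>[of "(1, x)"] G1[OF that] that by (simp add: \<psi>_def ht_def \<Phi>_def)
  have F_side: "F (cone_proj (a, t)) = cone_proj (a, t)" if "a \<in> A" "t \<in> {0..1}" for a t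
  proof -
    have a: "a \<in> topspace X" "d a = 0"
      using that AX d0 by auto
    then show ?thesis
      using F\<psi>[of "(t, a)"] G_out[of t a] AU[OF that(1)] that by (simp add: \<psi>_def ht_def \<Phi>_def)
  qed
  have "cone_proj (p, 1/2) \<notin> \<Phi> ` topspace ?Y"
  proof
    assume "cone_proj (p, 1/2) \<in> \<Phi> ` topspace ?Y"
    then obtain t x where tx: "t \<in> {-1..1}" "x \<in> topspace X" "\<Phi> (t, x) = cone_proj (p, 1/2)"
      by (auto simp: image_iff)
    show False
    proof (cases "0 \<le> t")
      case True
      then show False
        using G_miss[of t x] tx by (simp add: \<Phi>_def)
    next
      case False
      then have "l (H (- t, x)) \<in> (\<lambda>x. G (0, x)) ` topspace X"
        using H_in[of "- t" x] tx l_im by (metis abs_le_iff abs_of_neg atLeastAtMost_iff imageI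
            linorder_not_le minus_le_iff neg_0_le_iff_le nle_le)
      then obtain x' where "x' \<in> topspace X" "l (H (- t, x)) = G (0, x')"
        by blast
      then show False
        using G_miss[of 0 x'] tx False by (simp add: \<Phi>_def)
    qed
  qed
  moreover have "cone_proj (p, 1/2) \<in> topspace (cone_space X)"
    using pX by simp
  ultimately show ?thesis
    using contF F_im F_top F_side unfolding surjection_property_def cone_pair_subset_def by blast
qed

section \<open>The sphere as a quotient of a cell\<close>

definition sphere_pole :: "nat \<Rightarrow> nat \<Rightarrow> real" where
  "sphere_pole n = (\<lambda>i. if i = n then 1 else 0)"

text \<open>Wraps the ball around the sphere: the centre goes to the south pole and the boundary to the north pole
  \<^const>\<open>sphere_pole\<close>. The point with radius \<open>r\<close> has last coordinate \<open>2 r\<^sup>2 - 1\<close>, and the factor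
  \<open>2 sqrt (1 - r\<^sup>2)\<close> is forced by \<open>4 r\<^sup>2 (1 - r\<^sup>2) + (2 r\<^sup>2 - 1)\<^sup>2 = 1\<close>.\<close>

definition ball_to_sphere :: "nat \<Rightarrow> (nat \<Rightarrow> real) \<Rightarrow> (nat \<Rightarrow> real)" where
  "ball_to_sphere n v = (\<lambda>i. if i = n then 2 * (enorm n v)\<^sup>2 - 1 else 2 * sqrt (1 - (enorm n v)\<^sup>2) * v i)"

lemma enorm_power2: "(enorm n v)\<^sup>2 = (\<Sum>i<n. (v i)\<^sup>2)"
  by (simp add: L2_set_def sum_nonneg)

lemma ball_to_sphere_in_nsphere:
  assumes "v \<in> closed_unit_ball n"
  shows "ball_to_sphere n v \<in> topspace (nsphere n)"
proof -
  define r where "r = enorm n v"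
  have r: "0 \<le> r" "r\<^sup>2 \<le> 1"
    using assms by (simp_all add: r_def closed_unit_ball_eq abs_square_le_1)
  have "(\<Sum>i<n. (ball_to_sphere n v i)\<^sup>2) = (\<Sum>i<n. 4 * (1 - r\<^sup>2) * (v i)\<^sup>2)"
    using r by (intro sum.cong) (auto simp: ball_to_sphere_def power_mult_distrib r_def)
  also have "\<dots> = 4 * (1 - r\<^sup>2) * r\<^sup>2"
    by (simp add: r_def enorm_power2 flip: sum_distrib_left)
  finally have "(\<Sum>i\<le>n. (ball_to_sphere n v i)\<^sup>2) = 4 * (1 - r\<^sup>2) * r\<^sup>2 + (2 * r\<^sup>2 - 1)\<^sup>2"
    by (simp add: lessThan_Suc_atMost[symmetric] ball_to_sphere_def r_def)
  also have "\<dots> = 1"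
    by (simp add: power2_eq_square algebra_simps)
  finally show ?thesis
    using assms by (auto simp: nsphere ball_to_sphere_def closed_unit_ball_eq)
qed

lemma ball_to_sphere_boundary:
  assumes "v \<in> closed_unit_ball n" "enorm n v = 1"
  shows "ball_to_sphere n v = sphere_pole n"
  using assms by (auto simp: ball_to_sphere_def sphere_pole_def)

lemma ball_to_sphere_eq_pole_iff:
  assumes "v \<in> closed_unit_ball n"
  shows "ball_to_sphere n v = sphere_pole n \<longleftrightarrow> enorm n v = 1"
proof
  assume "ball_to_sphere n v = sphere_pole n"
  then have "ball_to_sphere n v n = sphere_pole n n"
    by simp
  then have "(enorm n v)\<^sup>2 = 1"
    by (simp add: ball_to_sphere_def sphere_pole_def)
  then show "enorm n v = 1"
    by (simp add: power2_eq_1_iff) (smt (verit) L2_set_nonneg)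
qed (use assms ball_to_sphere_boundary in blast)

lemma ball_to_sphere_inj:
  assumes v: "v \<in> closed_unit_ball n" "enorm n v < 1" and w: "w \<in> closed_unit_ball n" "enorm n w < 1"
    and eq: "ball_to_sphere n v = ball_to_sphere n w"
  shows "v = w"
proof
  fix i
  have "ball_to_sphere n v n = ball_to_sphere n w n"
    using eq by simp
  then have sq: "(enorm n v)\<^sup>2 = (enorm n w)\<^sup>2"
    by (simp add: ball_to_sphere_def)
  have pos: "sqrt (1 - (enorm n w)\<^sup>2) > 0"
    using w by (simp add: abs_square_less_1)
  show "v i = w i"
  proof (cases "i < n")
    case True
    then have "2 * sqrt (1 - (enorm n w)\<^sup>2) * v i = 2 * sqrt (1 - (enorm n w)\<^sup>2) * w i"
      using fun_cong[OF eq, of i] unfolding ball_to_sphere_def sq by simp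
    then show ?thesis using pos by simp
  next
    case False
    then show ?thesis
      using v w by (simp add: closed_unit_ball_eq)
  qed
qed

lemma ball_to_sphere_onto:
  assumes n: "1 \<le> n" and y: "y \<in> topspace (nsphere n)"
  obtains v where "v \<in> closed_unit_ball n" "ball_to_sphere n v = y"
proof (cases "y = sphere_pole n")
  case True
  define v :: "nat \<Rightarrow> real" where "v = (\<lambda>i. if i = 0 then 1 else 0)"
  have "(\<Sum>i<n. (v i)\<^sup>2) = (\<Sum>i\<in>{0}. (v i)\<^sup>2)"
    using n by (intro sum.mono_neutral_right) (auto simp: v_def)
  then have "enorm n v = 1"
    by (simp add: L2_set_def v_def)
  moreover have "v \<in> closed_unit_ball n"
    using n \<open>enorm n v = 1\<close> by (auto simp: closed_unit_ball_eq v_def)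
  ultimately show thesis
    using that ball_to_sphere_boundary True by metis
next
  case False
  have y0: "\<forall>i>n. y i = 0" and sum: "(\<Sum>i<n. (y i)\<^sup>2) = 1 - (y n)\<^sup>2"
    using y by (simp_all add: nsphere lessThan_Suc_atMost[symmetric])
  have "y n \<noteq> 1"
  proof
    assume yn: "y n = 1"
    then have "\<forall>i<n. y i = 0"
      using sum by (simp add: sum_nonneg_eq_0_iff)
    then have "y i = sphere_pole n i" for i
      using y0 yn by (cases i n rule: linorder_cases) (auto simp: sphere_pole_def)
    then show False
      using False by blast
  qed
  have "(y n)\<^sup>2 \<le> 1"
    using sum sum_nonneg[of "{..<n}" "\<lambda>i. (y i)\<^sup>2"] by simp
  then have yn: "-1 \<le> y n" "y n < 1"
    using \<open>y n \<noteq> 1\<close> by (auto simp: abs_square_le_1 abs_le_iff)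
  \<comment> \<open>The radius of the preimage must satisfy \<open>2 r\<^sup>2 - 1 = y n\<close>, so \<open>k = 2 sqrt (1 - r\<^sup>2)\<close> is the factor to
    divide by.\<close>
  define k where "k = 2 * sqrt ((1 - y n) / 2)"
  have k: "k > 0" "k\<^sup>2 = 2 * (1 - y n)"
    using yn by (simp_all add: k_def power_mult_distrib)
  define v where "v = (\<lambda>i. if i = n then 0 else y i / k)"
  have "(enorm n v)\<^sup>2 = (\<Sum>i<n. (y i)\<^sup>2 / k\<^sup>2)"
    unfolding enorm_power2 by (intro sum.cong) (auto simp: v_def power_divide)
  also have "\<dots> = (1 - (y n)\<^sup>2) / k\<^sup>2"
    by (simp add: sum flip: sum_divide_distrib)
  also have "\<dots> = (1 + y n) / 2"
    using yn unfolding k(2) by (simp add: field_simps power2_eq_square)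
  finally have r: "(enorm n v)\<^sup>2 = (1 + y n) / 2" .
  have "enorm n v \<le> 1"
    using r yn by (intro power2_le_imp_le[of "enorm n v" 1]) simp_all
  then have "v \<in> closed_unit_ball n"
    using y0 by (auto simp: closed_unit_ball_eq v_def)
  moreover have "ball_to_sphere n v i = y i" for i
  proof (cases "i = n")
    case True
    then show ?thesis by (simp add: ball_to_sphere_def r field_simps)
  next
    case False
    have "1 - (1 + y n) / 2 = (1 - y n) / 2"
      by (simp add: field_simps)
    then have "2 * sqrt (1 - (enorm n v)\<^sup>2) = k"
      unfolding r k_def by simp
    then show ?thesis
      using False k by (simp add: ball_to_sphere_def v_def)
  qed
  ultimately show thesis
    using that by blast
qed

lemma continuous_map_ball_to_sphere:
  "continuous_map (top_of_set (closed_unit_ball n)) (nsphere n) (ball_to_sphere n)"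
proof -
  have coord: "continuous_on S (\<lambda>v::nat \<Rightarrow> real. v i)" for S i
    by (rule continuous_on_subset [OF continuous_on_product_coordinates]) simp
  have "continuous_on S (\<lambda>v. ball_to_sphere n v i)" for S i
  proof (cases "i = n")
    case True
    then show ?thesis
      unfolding ball_to_sphere_def by (simp, intro continuous_intros)
  next
    case False
    then show ?thesis
      unfolding ball_to_sphere_def by (simp, intro continuous_intros coord)
  qed
  then have "continuous_on (closed_unit_ball n) (ball_to_sphere n)"
    by (rule continuous_on_coordinatewise_then_product)
  then show ?thesis
    using ball_to_sphere_in_nsphere[of _ n]
    unfolding nsphere_eq_top_of_set continuous_map_in_subtopology
    by auto
qed

text \<open>Wrapping the cell around the sphere and sending the rest of \<open>X\<close> to the pole is a continuous surjection
  from a compact space to a Hausdorff space, hence a quotient map. It identifies exactly the points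
  outside the open cell, so it induces a homeomorphism from the collapsed space to the sphere.\<close>

lemma cell_quotient_map_exists:
  assumes X: "compact_space X" "Hausdorff_space X" and n: "1 \<le> n" and C: "C \<subseteq> topspace X"
    and chart: "cell_chart X n C \<phi>"
  obtains q s where "cell_quotient_map X n C q s" "s \<in> topspace (nsphere n)"
    "\<And>x. x \<in> topspace X - \<phi> ` (closed_unit_ball n - unit_sphere n) \<Longrightarrow> q x = s"
proof -
  let ?B = "closed_unit_ball n"
  define U where "U = \<phi> ` (?B - unit_sphere n)"
  obtain \<psi> where cont\<phi>: "continuous_map (top_of_set ?B) X \<phi>"
    and cont\<psi>: "continuous_map (subtopology X C) (top_of_set ?B) \<psi>"
    and inv1: "\<And>v. v \<in> ?B \<Longrightarrow> \<phi> v \<in> C \<and> \<psi> (\<phi> v) = v"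
    and inv2: "\<And>x. x \<in> C \<Longrightarrow> \<psi> x \<in> ?B \<and> \<phi> (\<psi> x) = x"
    and clo: "closedin X C" and op: "openin X U" and UC: "U \<subseteq> C"
    and mem: "\<And>x. x \<in> C \<Longrightarrow> x \<in> U \<longleftrightarrow> enorm n (\<psi> x) < 1"
    using cell_chartE[OF X(2) chart C U_def] by blast
  define s where "s = sphere_pole n"
  define g where "g = (\<lambda>x. if x \<in> C then ball_to_sphere n (\<psi> x) else s)"
  have s: "s \<in> topspace (nsphere n)"
    by (simp add: s_def sphere_pole_def nsphere lessThan_Suc_atMost[symmetric])
  have out: "enorm n (\<psi> x) = 1" if "x \<in> C" "x \<notin> U" for x
    using that inv2[of x] mem[of x] by (auto simp: closed_unit_ball_eq)
  have g_s: "g x = s \<longleftrightarrow> x \<notin> U" for x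
  proof (cases "x \<in> C")
    case True
    then have "g x = s \<longleftrightarrow> enorm n (\<psi> x) = 1"
      using inv2[of x] ball_to_sphere_eq_pole_iff by (simp add: g_def s_def)
    then show ?thesis
      using True mem out by auto
  next
    case False
    then show ?thesis
      using UC by (auto simp: g_def)
  qed
  have g_inj: "x = y" if "x \<in> U" "y \<in> U" "g x = g y" for x y
  proof -
    have "\<psi> x = \<psi> y"
      using that UC inv2 mem by (intro ball_to_sphere_inj[of "\<psi> x" n "\<psi> y"]) (auto simp: g_def subset_iff)
    then show ?thesis
      using that UC inv2 by (metis subsetD)
  qed
  have contg: "continuous_map X (nsphere n) g"
    unfolding g_def
  proof (rule continuous_map_paste_closed[where Q = "\<lambda>x. x \<notin> U"])
    show "closedin X {x \<in> topspace X. x \<in> C}"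
      using clo C by (simp add: Collect_conj_eq inf.absorb2)
    show "closedin X {x \<in> topspace X. x \<notin> U}"
      using op openin_closedin_eq set_diff_eq by metis
    have "continuous_map (subtopology X C) (nsphere n) (ball_to_sphere n \<circ> \<psi>)"
      using cont\<psi> continuous_map_ball_to_sphere by (rule continuous_map_compose)
    then show "continuous_map (subtopology X {x. x \<in> C}) (nsphere n) (\<lambda>x. ball_to_sphere n (\<psi> x))"
      by (simp add: o_def)
    show "ball_to_sphere n (\<psi> x) = s" if "x \<in> topspace X" "x \<in> C" "x \<notin> U" for x
      using that g_s[of x] by (simp add: g_def)
  qed (use UC s in auto)
  have g_onto: "g ` topspace X = topspace (nsphere n)"
  proof
    show "g ` topspace X \<subseteq> topspace (nsphere n)"
      using contg by (rule continuous_map_image_subset_topspace)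
    show "topspace (nsphere n) \<subseteq> g ` topspace X"
    proof
      fix y assume "y \<in> topspace (nsphere n)"
      then obtain v where v: "v \<in> ?B" "ball_to_sphere n v = y"
        using ball_to_sphere_onto n by metis
      then have "g (\<phi> v) = y" "\<phi> v \<in> topspace X"
        using inv1[OF v(1)] C by (auto simp: g_def)
      then show "y \<in> g ` topspace X"
        by blast
    qed
  qed
  have "Hausdorff_space (nsphere n)"
    by (simp add: nsphere_eq_top_of_set Hausdorff_space_subtopology)
  then have quot: "quotient_map X (nsphere n) g"
    using T1_Spaces.continuous_imp_quotient_map contg X(1) g_onto by blast
  let ?Q = "quotient_topology X (collapse_complement U)"
  define h where "h = (\<lambda>z. case z of None \<Rightarrow> s | Some x \<Rightarrow> g x)"
  have hc: "h \<circ> collapse_complement U = g"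
  proof
    show "(h \<circ> collapse_complement U) x = g x" for x
      using g_s[of x] by (cases "x \<in> U") (auto simp: h_def collapse_complement_def)
  qed
  have "homeomorphic_map ?Q (nsphere n) h"
    unfolding homeomorphic_map_def
  proof
    show "quotient_map ?Q (nsphere n) h"
      using quotient_map_compose_eq[OF quotient_map_quotient_topology, of X "nsphere n" h "collapse_complement U"]
      by (simp add: hc quot)
    show "inj_on h (topspace ?Q)"
      using g_s g_inj
      by (auto simp: inj_on_def topspace_quotient_topology collapse_complement_def h_def split: if_splits) (metis g_s)+
  qed
  then have "cell_quotient_map X n C g s"
    unfolding cell_quotient_map_def using chart U_def hc by (metis h_def option.simps(4))
  then show thesis
    using that[of g s] s g_s by (simp add: U_def)
qed

section \<open>Small cells at Euclidean points\<close>

text \<open>Small round balls about the given point of Euclidean space stay inside the preimage of \<open>W\<close>; by the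
  tube lemma one radius \<open>\<delta>\<close> works for all directions, as the ball is compact.\<close>

lemma small_cell_exists:
  assumes W: "openin X W" "x0 \<in> W" and V: "openin X V" "x0 \<in> V"
    and hom: "subtopology X V homeomorphic_space Euclidean_space n"
  obtains C \<phi> where "C \<subseteq> W" "cell_chart X n C \<phi>"
proof -
  let ?B = "closed_unit_ball n"
  obtain g f where gf: "homeomorphic_maps (Euclidean_space n) (subtopology X V) g f"
    using hom homeomorphic_space_def homeomorphic_space_sym by metis
  then have contg: "continuous_map (Euclidean_space n) (subtopology X V) g"
    by (simp add: homeomorphic_maps_def)
  have hg: "homeomorphic_map (Euclidean_space n) (subtopology X V) g"
    using gf homeomorphic_map_maps by metis
  have topV: "topspace (subtopology X V) = V"
    using V openin_subset by fastforce
  define v0 where "v0 = f x0"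
  have v0: "v0 \<in> topspace (Euclidean_space n)" "g v0 = x0"
    using gf V topV unfolding homeomorphic_maps_def continuous_map_def v0_def by auto
  define a where "a = (\<lambda>(\<delta>::real, v::nat \<Rightarrow> real). (\<lambda>i. v0 i + \<delta> * v i))"
  have conta: "continuous_on S a" for S
  proof (rule continuous_on_coordinatewise_then_product)
    have "continuous_on S (\<lambda>y::real \<times> (nat \<Rightarrow> real). snd y i)" for i
      by (rule continuous_on_product_then_coordinatewise, rule continuous_on_snd, rule continuous_on_id)
    then show "continuous_on S (\<lambda>y. a y i)" for i
      unfolding a_def case_prod_unfold by (intro continuous_intros) auto
  qed
  let ?P = "{v \<in> topspace (Euclidean_space n). g v \<in> W}"
  have "openin (Euclidean_space n) ?P"
    using openin_continuous_map_preimage[of "Euclidean_space n" X g W] contg W continuous_map_in_subtopology by blast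
  then obtain P where P: "open P" "?P = topspace (Euclidean_space n) \<inter> P"
    unfolding openin_Euclidean_space_iff by (elim exE conjE)
  have "open (a -` P)"
    using P(1) conta[of UNIV] by (rule open_vimage)
  moreover have "{0} \<times> ?B \<subseteq> a -` P"
    using v0 W P(2) by (auto simp: a_def)
  ultimately obtain D where D: "0 \<in> D" "open D" "D \<times> ?B \<subseteq> a -` P"
    using Elementary_Topology.tube_lemma[OF compact_closed_unit_ball] by metis
  obtain e where e: "e > 0" "ball 0 e \<subseteq> D"
    using D openE by blast
  define \<delta> where "\<delta> = e / 2"
  have \<delta>: "\<delta> > 0" "\<delta> \<in> D"
    using e by (auto simp: \<delta>_def subset_iff)
  define T where "T = (\<lambda>v. a (\<delta>, v))"
  have T_E: "T v \<in> topspace (Euclidean_space n)" if "v \<in> topspace (Euclidean_space n)" for v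
    using that v0(1) by (auto simp: T_def a_def topspace_Euclidean_space)
  have BE: "?B \<subseteq> topspace (Euclidean_space n)"
    by (auto simp: closed_unit_ball_def)
  have contT: "continuous_map (Euclidean_space n) (Euclidean_space n) T"
  proof -
    have "continuous_on S T" for S
      unfolding T_def by (intro continuous_on_compose2[OF conta[of UNIV]] continuous_intros) auto
    then show ?thesis
      using T_E unfolding Euclidean_space_eq_top_of_set continuous_map_in_subtopology by auto
  qed
  \<comment> \<open>\<open>T\<close> moves the unit ball to the small ball about \<open>v0\<close>; \<open>R\<close> is its inverse.\<close>
  define R where "R = (\<lambda>w i. (w i - v0 i) / \<delta>)"
  have contR: "continuous_map (Euclidean_space n) (Euclidean_space n) R"
  proof -
    have "continuous_on S (\<lambda>w. R w i)" for S i
      unfolding R_def using \<delta> by (intro continuous_intros continuous_on_product_then_coordinatewise) auto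
    then have "continuous_on S R" for S
      by (rule continuous_on_coordinatewise_then_product)
    then show ?thesis
      using v0(1) unfolding Euclidean_space_eq_top_of_set continuous_map_in_subtopology by (auto simp: R_def)
  qed
  have "homeomorphic_maps (Euclidean_space n) (Euclidean_space n) T R"
    unfolding homeomorphic_maps_def using contT contR \<delta> by (auto simp: T_def a_def R_def)
  then have "homeomorphic_map (Euclidean_space n) (subtopology X V) (g \<circ> T)"
    using homeomorphic_map_compose hg homeomorphic_map_maps by blast
  moreover define \<phi> where "\<phi> = g \<circ> T"
  ultimately have h\<phi>: "homeomorphic_map (Euclidean_space n) (subtopology X V) \<phi>"
    by simp
  have \<phi>V: "\<phi> ` topspace (Euclidean_space n) = V"
    using h\<phi> topV homeomorphic_imp_surjective_map by metis
  show thesis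
  proof
    show "\<phi> ` ?B \<subseteq> W"
    proof
      fix x assume "x \<in> \<phi> ` ?B"
      then obtain v where v: "v \<in> ?B" "x = g (T v)"
        by (auto simp: \<phi>_def)
      have "T v \<in> P"
        using D(3) \<delta>(2) v(1) by (auto simp: T_def)
      then show "x \<in> W"
        using P(2) T_E BE v by blast
    qed
    have "homeomorphic_map (subtopology (Euclidean_space n) ?B) (subtopology (subtopology X V) (\<phi> ` ?B)) \<phi>"
      by (rule homeomorphic_map_subtopologies[OF h\<phi>]) (use BE \<phi>V topV in auto)
    moreover have "subtopology (subtopology X V) (\<phi> ` ?B) = subtopology X (\<phi> ` ?B)"
      unfolding subtopology_subtopology using BE \<phi>V by (metis image_mono inf.absorb_iff2)
    moreover have "openin X (\<phi> ` (?B - unit_sphere n))"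
    proof -
      have "?B - unit_sphere n = topspace (Euclidean_space n) \<inter> {v. enorm n v < 1}"
        by (auto simp: closed_unit_ball_eq unit_sphere_eq topspace_Euclidean_space)
      moreover have "open {v. enorm n v < 1}"
        by (intro open_Collect_less continuous_intros)
      ultimately have "openin (Euclidean_space n) (?B - unit_sphere n)"
        unfolding Euclidean_space_eq_top_of_set by (auto simp: openin_open)
      then have "openin (subtopology X V) (\<phi> ` (?B - unit_sphere n))"
        using h\<phi> homeomorphic_imp_open_map open_map_def by blast
      then show ?thesis
        using V(1) openin_trans_full by blast
    qed
    ultimately show "cell_chart X n (\<phi> ` ?B) \<phi>"
      unfolding cell_chart_def by simp
  qed
qed

section \<open>Non-surjective maps yield null-homotopic quotient maps\<close>

text \<open>If \<open>F\<close> fixes the top and the cone over \<open>A\<close> but is not onto, its image is compact, so it misses an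
  open set, which contains a level set \<open>C \<times> {t}\<close> over some small cell \<open>C\<close>. The cone without the open
  part of that level set maps to the sphere by \<open>q\<close> above height \<open>t\<close> and by the constant \<open>s\<close> below: the two
  agree at height \<open>t\<close>, because what is left there lies outside the open cell. Composing \<open>F\<close> with this map
  and moving from the top to the tip contracts \<open>q\<close>.\<close>

lemma not_surjection_property_imp_null_homotopic:
  assumes cp: "compact_pair X A" and ae: "almost_Euclidean_pair X A"
    and ns: "\<not> surjection_property (cone_space X) (cone_pair_subset X A)"
  obtains n C q s where "1 \<le> n" "regular_cell X n C" "C \<subseteq> topspace X - A"
    "cell_quotient_map X n C q s" "pair_null_homotopic X A (nsphere n) {s} q"
proof -
  let ?Z = "cone_space X"
  have X: "compact_space X" "metrizable_space X" "Hausdorff_space X" and A: "closedin X A"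
    using cp by (auto simp: compact_pair_def metrizable_imp_Hausdorff_space compactin_imp_closedin)
  have AX: "A \<subseteq> topspace X"
    using A closedin_subset by blast
  obtain F where contF: "continuous_map ?Z ?Z F" and Fid: "\<And>b. b \<in> cone_pair_subset X A \<Longrightarrow> F b = b"
    and "F ` topspace ?Z \<noteq> topspace ?Z"
    using ns unfolding surjection_property_def by blast
  moreover have "F ` topspace ?Z \<subseteq> topspace ?Z"
    using contF by (rule continuous_map_image_subset_topspace)
  ultimately obtain z where z: "z \<in> topspace ?Z" "z \<notin> F ` topspace ?Z"
    by blast
  have F_top: "F (cone_proj (x, 1)) = cone_proj (x, 1)" if "x \<in> topspace X" for x
    using that by (intro Fid) (auto simp: cone_pair_subset_def)
  have F_side: "F (cone_proj (a, t)) = cone_proj (a, t)" if "a \<in> A" "t \<in> {0..1}" for a t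
    using that by (intro Fid) (auto simp: cone_pair_subset_def)
  let ?P = "prod_topology X (top_of_set {0..1::real})"
  define O' where "O' = {y \<in> topspace ?P. cone_proj y \<in> topspace ?Z - F ` topspace ?Z}"
  have "compactin ?Z (F ` topspace ?Z)"
    using compact_space_cone[OF X(1)] contF image_compactin unfolding compact_space_def by blast
  then have "closedin ?Z (F ` topspace ?Z)"
    using Hausdorff_space_cone[OF X(3)] compactin_imp_closedin by blast
  then have "openin ?Z (topspace ?Z - F ` topspace ?Z)"
    by blast
  then have opO: "openin ?P O'"
    unfolding O'_def using continuous_map_cone_proj openin_continuous_map_preimage by blast
  \<comment> \<open>If the tip is missed, so are points of small positive height.\<close>
  obtain x t where xt: "(x, t) \<in> O'" "t > 0"
  proof -
    obtain x u where xu: "z = cone_proj (x, u)" "x \<in> topspace X" "0 \<le> u" "u \<le> 1"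
      using z(1) by (rule in_cone_spaceE)
    then have "(x, u) \<in> O'"
      using z by (simp add: O'_def)
    then obtain U V where UV: "openin X U" "openin (top_of_set {0..1}) V" "x \<in> U" "u \<in> V" "U \<times> V \<subseteq> O'"
      using openin_prod_topology_alt[THEN iffD1, rule_format, OF opO] by metis
    then obtain T where T: "open T" "V = {0..1} \<inter> T"
      by (auto simp: openin_open)
    then have "u \<in> T"
      using UV(4) by blast
    then obtain e where e: "e > 0" "ball u e \<subseteq> T"
      using openE[OF T(1)] by metis
    show thesis
    proof (cases "u > 0")
      case True
      then show thesis
        using that \<open>(x, u) \<in> O'\<close> by blast
    next
      case False
      then have "u = 0"
        using xu by simp
      then have "min (e/2) 1 \<in> V"
        using e T by (auto simp: subset_iff dist_real_def)
      then show thesis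
        using that[of x "min (e/2) 1"] UV e by auto
    qed
  qed
  have t1: "t \<le> 1"
    using xt by (auto simp: O'_def)
  have "t \<noteq> 1"
  proof
    assume "t = 1"
    then have "x \<in> topspace X" "cone_proj (x, 1) \<notin> F ` topspace ?Z"
      using xt by (auto simp: O'_def)
    then show False
      using F_top[of x] by (metis cone_proj_in_cone_space image_eqI order_refl zero_le_one)
  qed
  define W where "W = {x \<in> topspace X. (x, t) \<in> O'}"
  have "continuous_map X ?P (\<lambda>x. (x, t))"
    using xt t1 by (intro continuous_map_pairedI) auto
  then have opW: "openin X W"
    unfolding W_def using opO by (rule openin_continuous_map_preimage)
  have xW: "x \<in> W"
    using xt by (auto simp: W_def O'_def)
  have W_miss: "cone_proj (w, t) \<notin> F ` topspace ?Z" if "w \<in> W" for w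
    using that by (auto simp: W_def O'_def)
  have WA: "W \<inter> A = {}"
  proof -
    have "w \<notin> A" if "w \<in> W" for w
    proof
      assume "w \<in> A"
      then have "F (cone_proj (w, t)) = cone_proj (w, t)" "cone_proj (w, t) \<in> topspace ?Z"
        using F_side[of w t] xt t1 AX by auto
      then show False
        using W_miss[OF that] by (metis imageI)
    qed
    then show ?thesis by blast
  qed
  have WX: "W \<subseteq> topspace X - A"
    using WA by (auto simp: W_def)
  let ?XA = "subtopology X (topspace X - A)"
  have opXA: "openin X (topspace X - A)"
    using A by blast
  have "openin ?XA W"
    using opW WX by (simp add: openin_open_subtopology[OF opXA])
  then obtain x0 where x0: "x0 \<in> W" "Euclidean_point ?XA x0"
    using ae xW unfolding almost_Euclidean_pair_def almost_Euclidean_space_def dense_intersects_open by blast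
  then obtain V n where V: "openin ?XA V" "x0 \<in> V" "1 \<le> n"
    "subtopology ?XA V homeomorphic_space Euclidean_space n"
    unfolding Euclidean_point_def by blast
  have V': "openin X V" "V \<subseteq> topspace X - A"
    using V(1) by (simp_all add: openin_open_subtopology[OF opXA])
  then have "subtopology X V homeomorphic_space Euclidean_space n"
    using V(4) by (simp add: subtopology_subtopology inf.absorb2)
  then obtain C \<phi> where C: "C \<subseteq> W" and chart: "cell_chart X n C \<phi>"
    using small_cell_exists[OF opW x0(1) V'(1) V(2)] by blast
  have CX: "C \<subseteq> topspace X"
    using C WX by blast
  define U where "U = \<phi> ` (closed_unit_ball n - unit_sphere n)"
  obtain q s where cq: "cell_quotient_map X n C q s" and s: "s \<in> topspace (nsphere n)"
    and q_out: "\<And>x. x \<in> topspace X - U \<Longrightarrow> q x = s"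
    using cell_quotient_map_exists[OF X(1) X(3) V(3) CX chart] U_def by metis
  have UC: "U \<subseteq> C"
    using cell_chartE[OF X(3) chart CX U_def] by metis
  have contq: "continuous_map X (nsphere n) q"
    using quotient_map_cell_quotient_map[OF cq] quotient_imp_continuous_map by blast

  \<comment> \<open>The cone without the missed level set, and its map to the sphere.\<close>
  define M where "M = subtopology ?Z (- cone_proj ` (U \<times> {t}))"
  define r where "r = (\<lambda>z. if t \<le> cone_height z then q (cone_base z) else s)"
  have ht: "continuous_map M euclideanreal cone_height"
    using continuous_map_cone_height unfolding M_def
    by (intro continuous_map_from_subtopology) (rule continuous_map_into_fulltopology)
  have contr: "continuous_map M (nsphere n) r"
    unfolding r_def
  proof (rule continuous_map_paste_closed[where Q = "\<lambda>z. cone_height z \<le> t"])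
    have "closedin M {y \<in> topspace M. cone_height y \<in> {t..}}" "closedin M {y \<in> topspace M. cone_height y \<in> {..t}}"
      by (intro closedin_continuous_map_preimage[OF ht]; simp)+
    then show "closedin M {y \<in> topspace M. t \<le> cone_height y}" "closedin M {y \<in> topspace M. cone_height y \<le> t}"
      by simp_all
    have "continuous_map (subtopology ?Z {z. cone_height z \<noteq> 0}) (nsphere n) (q \<circ> cone_base)"
      using continuous_map_cone_base contq by (rule continuous_map_compose)
    moreover have "subtopology M {y. t \<le> cone_height y}
        = subtopology (subtopology ?Z {z. cone_height z \<noteq> 0}) (- cone_proj ` (U \<times> {t}) \<inter> {y. t \<le> cone_height y})"
      unfolding M_def subtopology_subtopology using xt(2) by (intro arg_cong[where f = "subtopology ?Z"]) auto
    ultimately show "continuous_map (subtopology M {y. t \<le> cone_height y}) (nsphere n) (\<lambda>z. q (cone_base z))"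
      by (simp add: o_def continuous_map_from_subtopology)
    show "continuous_map (subtopology M {y. cone_height y \<le> t}) (nsphere n) (\<lambda>z. s)"
      using s by simp
    fix y assume y: "y \<in> topspace M" "t \<le> cone_height y" "cone_height y \<le> t"
    then obtain w u where w: "y = cone_proj (w, u)" "w \<in> topspace X"
      unfolding M_def by (auto elim: in_cone_spaceE)
    then have "u = t" "w \<notin> U"
      using y unfolding M_def by auto
    then show "q (cone_base y) = s"
      using w xt(2) q_out by simp
  qed auto
  have "F \<in> topspace ?Z \<rightarrow> - cone_proj ` (U \<times> {t})"
  proof
    fix z assume z: "z \<in> topspace ?Z"
    have "F z \<noteq> cone_proj (w, t)" if "w \<in> U" for w
      using W_miss[of w] imageI[OF z, of F] that UC C by (metis subsetD)
    then show "F z \<in> - cone_proj ` (U \<times> {t})"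
      by auto
  qed
  then have contF': "continuous_map ?Z M F"
    unfolding M_def using contF continuous_map_into_subtopology by blast
  let ?I = "prod_topology (top_of_set {0..1::real}) X"
  define H where "H = (\<lambda>y. r (F (cone_proj (snd y, 1 - fst y))))"
  have "continuous_map ?I (top_of_set {0..1}) (\<lambda>y. 1 - fst y)"
  proof -
    have "continuous_map ?I euclideanreal fst"
      using continuous_map_into_fulltopology continuous_map_fst by blast
    then show ?thesis
      unfolding continuous_map_in_subtopology by (auto intro!: continuous_map_diff)
  qed
  then have "continuous_map ?I ?Z (\<lambda>y. cone_proj (snd y, 1 - fst y))"
    by (intro continuous_map_into_cone continuous_map_snd)
  then have contH: "continuous_map ?I (nsphere n) H"
    using continuous_map_compose[OF _ continuous_map_compose[OF contF' contr]] unfolding H_def o_def by blast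
  define c where "c = H (1, x)"
  have c: "c \<in> topspace (nsphere n)"
    using continuous_map_funspace[OF contH] xW by (auto simp: c_def W_def Pi_iff)
  have H0: "H (0, y) = q y" if "y \<in> topspace X" for y
    using F_top[OF that] t1 by (simp add: H_def r_def)
  have H1: "H (1, y) = c" for y
    by (simp add: H_def c_def cone_proj_def)
  have HA: "H (u, a) = s" if "u \<in> {0..1}" "a \<in> A" for u a
  proof -
    have "q a = s"
      using that(2) UC C WA AX by (intro q_out) blast
    then show ?thesis
      using F_side[of a "1 - u"] that xt(2) by (auto simp: H_def r_def)
  qed
  have "homotopic_with (\<lambda>k. k ` A \<subseteq> {s}) X (nsphere n) q (\<lambda>x. c)"
  proof (subst homotopic_with)
    show "\<exists>h. continuous_map ?I (nsphere n) h \<and> (\<forall>x\<in>topspace X. h (0, x) = q x) \<and>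
        (\<forall>x\<in>topspace X. h (1, x) = c) \<and> (\<forall>t\<in>{0..1}. (\<lambda>x. h (t, x)) ` A \<subseteq> {s})"
      using contH H0 H1 HA by (intro exI[of _ H]) auto
    show "(h ` A \<subseteq> {s}) = (k ` A \<subseteq> {s})" if "\<And>x. x \<in> topspace X \<Longrightarrow> h x = k x" for h k
      using that AX by (metis image_cong subsetD)
  qed
  then have "pair_null_homotopic X A (nsphere n) {s} q"
    unfolding pair_null_homotopic_def using c by blast
  moreover have "regular_cell X n C"
    unfolding regular_cell_def using V(3) CX chart by blast
  ultimately show thesis
    using that V(3) C WX cq by blast
qed

section \<open>The surjection property of cone pairs\<close>

theorem theorem4p1:
  fixes X :: "'a topology" and A :: "'a set"
  assumes "compact_pair X A" and "almost_Euclidean_pair X A"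
  shows "surjection_property (cone_space X) (cone_pair_subset X A) \<longleftrightarrow>
    (\<forall>n\<ge>1. \<forall>C. regular_cell X n C \<and> C \<subseteq> topspace X - A \<longrightarrow>
       (\<forall>q s. cell_quotient_map X n C q s \<longrightarrow>
          \<not> pair_null_homotopic X A (nsphere n) {s} q))"
proof
  assume "surjection_property (cone_space X) (cone_pair_subset X A)"
  then show "\<forall>n\<ge>1. \<forall>C. regular_cell X n C \<and> C \<subseteq> topspace X - A \<longrightarrow>
       (\<forall>q s. cell_quotient_map X n C q s \<longrightarrow> \<not> pair_null_homotopic X A (nsphere n) {s} q)"
    using null_homotopic_imp_not_surjection_property[OF assms(1)] by blast
next
  assume "\<forall>n\<ge>1. \<forall>C. regular_cell X n C \<and> C \<subseteq> topspace X - A \<longrightarrow>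
       (\<forall>q s. cell_quotient_map X n C q s \<longrightarrow> \<not> pair_null_homotopic X A (nsphere n) {s} q)"
  then show "surjection_property (cone_space X) (cone_pair_subset X A)"
    using not_surjection_property_imp_null_homotopic[OF assms] by metis
qed

end
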